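(* Let $0<\lambda<1$, $\delta>\lambda/(1-\lambda)$ and $T=1/\delta$, or equivalently $T<1/\lambda-1$. Let $y^*$ be the state with $y^*_{0,0}=1-\lambda$, $y^*_{0,1}=0$, $y^*_{1,1}=\lambda$, and $y^*_{i,j}=0$ for all $j\ge i\ge 2$ (hence, as the entries sum to $1$, all entries other than $y^*_{0,0}$ and $y^*_{1,1}$ are zero). Let $y(\cdot)$ be a fluid trajectory with parameters $(\lambda,T)$. Then $y^*$ is a fixed point of the fluid-limit process at update moments in the following sense: (a) if $y(0)=y^*$, then $y(kT)=y^*$ for all integers $k\ge 0$; (b) for any initial state $y(0)$ with $Q(0)<\infty$, $y_{i,j}(kT)\to y^*_{i,j}$ for all $i\le j$ as $k\to\infty$. Moreover, in case (a), $y_{0,0}(kT+t)=1-\lambda-\lambda t$, $y_{0,1}(kT+t)=\lambda t$ and $y_{1,1}(kT+t)=\lambda$ for all $k\ge 0$, $t\in[0,T)$, and $y_{i,j}(t)=0$ for all $j\ge i\ge 2$, $t\ge 0$. In case (b), for every $t\in[0,T)$, as $k\to\infty$, $y_{0,0}(kT+t)\to 1-\lambda-\lambda t$, $y_{0,1}(kT+t)\to\lambda t$, $y_{1,1}(kT+t)\to\lambda$, and $y_{i,j}(kT+t)\to 0$ for all $j\ge i\ge 2$.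
   Context: A state is an array $y=(y_{i,j})_{0\le i\le j}$ of nonnegative reals with $\sum_{0\le i\le j}y_{i,j}=1$; $y_{i,j}$ is the fraction of servers with queue length $i$ and queue estimate $j$. For a state $y$ put $v_i=\sum_{l\ge i}y_{i,l}$, $w_j=\sum_{k=0}^{j}y_{k,j}$, $m=\min\{j:w_j>0\}$, $p_{i,j}=\frac{y_{i,j}}{w_j}\mathbf 1\{m=j\}$ (zero if $m\ne j$), and $Q=\sum_{i\ge 0} i\,v_i$. For a time-dependent state $y(t)$ these are written $v_i(t),w_j(t),m(t),p_{i,j}(t),Q(t)$. A fluid trajectory with parameters $(\lambda,T)$ (synchronous updates at times $0,T,2T,\dots$) is a state-valued function $y(t)$, $t\ge 0$, such that: (1) time $0$ is an update moment: $y_{i,j}(0)=0$ for $i<j$ (so $y_{i,i}(0)=v_i(0)$); (2) on each interval $[kT,(k+1)T)$, $k\ge0$, every $y_{i,j}$ is continuous, has a left limit at $(k+1)T$, and satisfies, except at the isolated times at which $m(t)$ changes, $$\frac{dy_{i,j}(t)}{dt}=y_{i+1,j}(t)\mathbf 1\{i<j\}-y_{i,j}(t)\mathbf 1\{i>0\}+\lambda p_{i-1,j-1}(t)\mathbf 1\{i>0\}-\lambda p_{i,j}(t);$$ (3) at every update moment $kT$, $k\ge1$: $y_{i,i}(kT)=v_i((kT)^-)=\sum_{l\ge i}y_{i,l}((kT)^-)$ and $y_{i,j}(kT)=0$ for $i<j$. *)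

theory Defs
  imports "HOL-Analysis.Analysis"
begin

text \<open>
  A state, an array indexed by \<open>0 \<le> i \<le> j\<close>, is encoded as a total function on pairs of naturals that
  vanishes for \<open>i > j\<close>, so that equality of states is equality of functions.
\<close>

definition is_state :: "(nat \<Rightarrow> nat \<Rightarrow> real) \<Rightarrow> bool" where
  "is_state y \<longleftrightarrow>
     (\<forall>i j. 0 \<le> y i j) \<and> (\<forall>i j. j < i \<longrightarrow> y i j = 0) \<and>
     ((\<lambda>(i, j). y i j) has_sum 1) {(i, j). i \<le> j}"

definition queue_frac :: "(nat \<Rightarrow> nat \<Rightarrow> real) \<Rightarrow> nat \<Rightarrow> real" where
  "queue_frac y i = (\<Sum>\<^sub>\<infinity>l\<in>{i..}. y i l)"

definition est_frac :: "(nat \<Rightarrow> nat \<Rightarrow> real) \<Rightarrow> nat \<Rightarrow> real" where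
  "est_frac y j = (\<Sum>k=0..j. y k j)"

definition min_est :: "(nat \<Rightarrow> nat \<Rightarrow> real) \<Rightarrow> nat" where
  "min_est y = (LEAST j. est_frac y j > 0)"

definition assign_prob :: "(nat \<Rightarrow> nat \<Rightarrow> real) \<Rightarrow> nat \<Rightarrow> nat \<Rightarrow> real" where
  "assign_prob y i j = (if min_est y = j then y i j / est_frac y j else 0)"

text \<open>The mean queue length is extended-valued, so that its finiteness is a genuine condition.\<close>

definition mean_queue :: "(nat \<Rightarrow> nat \<Rightarrow> real) \<Rightarrow> ennreal" where
  "mean_queue y = (\<Sum>i. ennreal (real i * queue_frac y i))"

definition fluid_rhs :: "real \<Rightarrow> (nat \<Rightarrow> nat \<Rightarrow> real) \<Rightarrow> nat \<Rightarrow> nat \<Rightarrow> real" where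
  "fluid_rhs lam y i j =
     (if i < j then y (i + 1) j else 0) - (if i > 0 then y i j else 0)
     + (if i > 0 then lam * assign_prob y (i - 1) (j - 1) else 0) - lam * assign_prob y i j"

text \<open>
  The times in \<open>I\<close> at which \<open>m(t)\<close> changes, i.e. is not locally constant relative to \<open>I\<close>.
\<close>

definition change_times :: "(real \<Rightarrow> nat \<Rightarrow> nat \<Rightarrow> real) \<Rightarrow> real set \<Rightarrow> real set" where
  "change_times y I =
     {t \<in> I. \<not> (\<forall>\<^sub>F s in at t within I. min_est (y s) = min_est (y t))}"

definition left_limit :: "(real \<Rightarrow> nat \<Rightarrow> nat \<Rightarrow> real) \<Rightarrow> real \<Rightarrow> nat \<Rightarrow> nat \<Rightarrow> real" where
  "left_limit y t i j = Lim (at_left t) (\<lambda>s. y s i j)"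

text \<open>
  Only the values at times \<open>t \<ge> 0\<close> matter. Continuity and derivatives are taken relative to the
  half-open interval between consecutive updates, hence are one-sided at its left end point.
  Since \<open>Lim\<close> is total, the existence of the left limits is required separately.
\<close>

definition fluid_trajectory ::
    "real \<Rightarrow> real \<Rightarrow> (real \<Rightarrow> nat \<Rightarrow> nat \<Rightarrow> real) \<Rightarrow> bool" where
  "fluid_trajectory lam T y \<longleftrightarrow>
     (\<forall>t\<ge>0. is_state (y t)) \<and>
     (\<forall>i j. i < j \<longrightarrow> y 0 i j = 0) \<and>
     (\<forall>k::nat. let I = {real k * T ..< real (k + 1) * T} in
        discrete (change_times y I) \<and>
        (\<forall>i j. i \<le> j \<longrightarrow>
           continuous_on I (\<lambda>t. y t i j) \<and>
           (\<exists>L. ((\<lambda>t. y t i j) \<longlongrightarrow> L) (at_left (real (k + 1) * T))) \<and>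
           (\<forall>t \<in> I - change_times y I.
              ((\<lambda>s. y s i j) has_real_derivative fluid_rhs lam (y t) i j) (at t within I)))) \<and>
     (\<forall>k::nat. k \<ge> 1 \<longrightarrow>
        (\<forall>i. y (real k * T) i i = queue_frac (left_limit y (real k * T)) i) \<and>
        (\<forall>i j. i < j \<longrightarrow> y (real k * T) i j = 0))"

definition y_star :: "real \<Rightarrow> nat \<Rightarrow> nat \<Rightarrow> real" where
  "y_star lam i j = (if i = 0 \<and> j = 0 then 1 - lam else if i = 1 \<and> j = 1 then lam else 0)"

lemma is_state_y_star:
  assumes "0 < lam" and "lam < 1"
  shows "is_state (y_star lam)"
proof -
  have "((\<lambda>(i, j). y_star lam i j) has_sum (\<Sum>(i, j)\<in>{(0,0),(1,1)}. y_star lam i j)) {(0,0),(1,1)}"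
    by (rule has_sum_finite) simp
  then have "((\<lambda>(i, j). y_star lam i j) has_sum 1) {(0,0),(1,1)}"
    by (simp add: y_star_def)
  moreover have "((\<lambda>(i, j). y_star lam i j) has_sum 1) {(0,0),(1,1)} \<longleftrightarrow>
      ((\<lambda>(i, j). y_star lam i j) has_sum 1) {(i, j). i \<le> j}"
    by (rule has_sum_cong_neutral) (auto simp: y_star_def split: if_splits)
  moreover have "\<forall>i j. 0 \<le> y_star lam i j" "\<forall>i j. j < i \<longrightarrow> y_star lam i j = 0"
    using assms by (auto simp: y_star_def)
  ultimately show ?thesis
    unfolding is_state_def by blast
qed

end

theory Submission
  imports Defs
begin

text \<open>
  The excess \<open>R = \<Sum>\<^sub>i (i - 1)\<^sup>+ v\<^sub>i\<close> and the busy fraction \<open>s = 1 - v\<^sub>0\<close> are combined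
  into the Lyapunov function \<open>V = R + max s lam\<close>, evaluated at update moments. Call a cycle good if
  at its start \<open>v\<^sub>0 \<ge> lam T\<close>. In a good cycle all jobs are sent to idle servers, so
  \<open>R\<close> does not increase, while \<open>Q = R + s\<close> has derivative \<open>lam - s\<close>; hence \<open>V\<close> does not increase.
  In any other cycle at most \<open>lam T - v\<^sub>0\<close> jobs join busy servers and busy servers become idle at
  rate at most one, and this forces both \<open>R + lam\<close> and \<open>Q\<close> at the end below the initial \<open>Q\<close>
  by at least \<open>(1 - lam - lam T) (1 - exp (- T))\<close>. This constant is positive by the assumption
  on \<open>T\<close>, so only finitely many cycles are not good. Afterwards the fraction of servers with two or
  more jobs is summable along the update moments, \<open>s - lam\<close> contracts by \<open>exp (- T)\<close> per cycle up
  to this fraction, and the entries \<open>(0,0)\<close>, \<open>(0,1)\<close>, \<open>(1,1)\<close> solve explicit linear equations.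
\<close>

subsection \<open>States and the weighted drift\<close>

lemma nondecreasing_except:
  fixes f :: "real \<Rightarrow> real"
  assumes "a \<le> b" and cont: "continuous_on {a..b} f"
    and fin: "\<And>c. c < b \<Longrightarrow> finite (D \<inter> {a..c})"
    and deriv: "\<And>t. a < t \<Longrightarrow> t < b \<Longrightarrow> t \<notin> D \<Longrightarrow> \<exists>d\<ge>0. (f has_real_derivative d) (at t)"
  shows "f a \<le> f b"
proof (cases "a = b")
  case False
  then have "a < b" using assms(1) by simp
  have *: "f a \<le> f c" if "a \<le> c" "c < b" for c
  proof -
    obtain f' where f': "\<And>t. a < t \<Longrightarrow> t < b \<Longrightarrow> t \<notin> D \<Longrightarrow>
        f' t \<ge> 0 \<and> (f has_real_derivative f' t) (at t)"
      using deriv by metis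
    have f0: "finite (D \<inter> {a..c})" using fin that by simp
    \<comment> \<open>The exceptional set may accumulate at \<open>b\<close>. On
      \<open>{a..c}\<close> with \<open>c < b\<close> it is finite, so the fundamental theorem of
      calculus applies there; the end point \<open>b\<close> is reached at the end by left
      continuity.\<close>
    have "(f' has_integral (f c - f a)) {a..c}"
    proof (rule fundamental_theorem_of_calculus_interior_strong[OF f0 \<open>a \<le> c\<close>])
      show "continuous_on {a..c} f"
        using cont that by (auto intro: continuous_on_subset)
    qed (use f' that in \<open>auto simp: has_real_derivative_iff_has_vector_derivative[symmetric]\<close>)
    \<comment> \<open>\<open>f'\<close> has no known sign at the end points and on \<open>D\<close>;
      replacing it by zero on this finite set makes the integrand nonnegative everywhere.\<close>
    then have "((\<lambda>t. if t \<in> {a<..<c} - D then f' t else 0) has_integral (f c - f a)) {a..c}"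
      by (rule has_integral_spike_finite[where S = "insert a (insert c (D \<inter> {a..c}))", rotated 2])
         (use f0 in auto)
    then have "0 \<le> f c - f a"
      by (rule has_integral_nonneg) (use f' that in auto)
    then show ?thesis by simp
  qed
  have "(f \<longlongrightarrow> f b) (at_left b)"
    using cont \<open>a < b\<close> by (rule continuous_on_Icc_at_leftD)
  then show ?thesis
    by (rule tendsto_lowerbound)
       (use * \<open>a < b\<close> in \<open>auto simp: eventually_at_left_field intro!: exI[of _ a]\<close>)
qed simp

text \<open>Discreteness alone allows accumulation at a point outside the set. Here such a point
  \<open>p\<close> would not be a change time, so \<open>min_est\<close> would be constant on a
  neighbourhood of \<open>p\<close> in the interval; then no nearby time could be a change
  time.\<close>

lemma finite_discrete_change_times:
  fixes a b c :: real
  assumes "discrete (change_times y {a..<b})" "c < b"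
  shows "finite (change_times y {a..<b} \<inter> {a..c})"
proof (rule ccontr)
  let ?C = "change_times y {a..<b}"
  assume "infinite (?C \<inter> {a..c})"
  then obtain p where p: "p \<in> {a..c}" "p islimpt (?C \<inter> {a..c})"
    using compact_eq_Bolzano_Weierstrass[of "{a..c}"] by (metis compact_Icc inf_le2)
  then have lim: "p islimpt ?C" by (meson inf_le1 islimpt_subset)
  show False
  proof (cases "p \<in> ?C")
    case True
    then show False using assms(1) lim by (meson discrete_def isolated_in_islimpt_iff)
  next
    case False
    then have "\<forall>\<^sub>F s in at p within {a..<b}. min_est (y s) = min_est (y p)"
      using p assms(2) by (auto simp: change_times_def)
    then obtain U where U: "open U" "p \<in> U"
      "\<And>s. s \<in> U \<Longrightarrow> s \<in> {a..<b} \<Longrightarrow> s \<noteq> p \<Longrightarrow> min_est (y s) = min_est (y p)"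
      unfolding eventually_at_topological by auto
    obtain q where q: "q \<in> ?C" "q \<in> U" "q \<noteq> p"
      using lim U unfolding islimpt_def by blast
    then have qI: "q \<in> {a..<b}" by (auto simp: change_times_def)
    have "\<forall>\<^sub>F s in at q within {a..<b}. min_est (y s) = min_est (y q)"
      unfolding eventually_at_topological
      by (rule exI[of _ U]) (use U q qI in \<open>metis (no_types, opaque_lifting)\<close>)
    then show False using q by (simp add: change_times_def)
  qed
qed

section \<open>Sums over a state and over the assignment probabilities\<close>

lemma state_partial_sum_le:
  assumes "is_state y"
  shows "(\<Sum>j\<le>J. \<Sum>i\<le>j. y i j) \<le> 1"
proof -
  have "(\<Sum>j\<le>J. \<Sum>i\<le>j. y i j) = (\<Sum>(j, i)\<in>Sigma {..J} (\<lambda>j. {..j}). y i j)"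
    by (rule sum.Sigma) auto
  also have "\<dots> = (\<Sum>(i, j)\<in>(\<lambda>(j, i). (i, j)) ` Sigma {..J} (\<lambda>j. {..j}). y i j)"
    by (subst sum.reindex) (auto simp: inj_on_def intro!: sum.cong)
  also have "\<dots> \<le> 1"
    using assms unfolding is_state_def
    by (intro has_sum_mono2[OF has_sum_finite]) (auto simp del: sum.reindex)
  finally show ?thesis .
qed

text \<open>Since the total mass is one, some estimate carries mass. Hence the \<open>LEAST\<close>
  in \<open>min_est\<close> is attained and \<open>assign_prob\<close> never divides by zero in the
  column that it selects.\<close>

lemma state_min_est_pos:
  assumes "is_state y"
  shows "est_frac y (min_est y) > 0"
proof -
  have "\<exists>j. est_frac y j > 0"
  proof (rule ccontr)
    assume neg: "\<not> ?thesis"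
    have "y i j = 0" for i j
    proof (cases "i \<le> j")
      case True
      have "y i j \<le> est_frac y j"
        unfolding est_frac_def by (rule member_le_sum) (use True assms in \<open>auto simp: is_state_def\<close>)
      then show ?thesis using neg assms by (smt (verit) is_state_def)
    qed (use assms in \<open>auto simp: is_state_def\<close>)
    then have "((\<lambda>(i, j). y i j) has_sum 0) {(i, j). i \<le> j}"
      by (intro has_sum_0) auto
    then show False using assms has_sum_unique unfolding is_state_def by fastforce
  qed
  then show ?thesis unfolding min_est_def by (rule LeastI_ex)
qed

lemma assign_prob_nonneg: "is_state y \<Longrightarrow> 0 \<le> assign_prob y i j"
  using state_min_est_pos[of y] by (auto simp: assign_prob_def is_state_def)

lemma sum_assign_prob:
  assumes "is_state y"
  shows "(\<Sum>i\<le>j. assign_prob y i j) = (if j = min_est y then 1 else 0)"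
  using state_min_est_pos[OF assms]
  by (auto simp: assign_prob_def atLeast0AtMost est_frac_def simp flip: sum_divide_distrib)

lemma diagonal_state_sums:
  assumes "is_state y" "\<And>i j. i < j \<Longrightarrow> y i j = 0"
  shows "(\<lambda>i. y i i) sums 1"
proof -
  have "((\<lambda>(i, j). y i j) has_sum 1) (range (\<lambda>i. (i, i)))"
  proof (subst has_sum_cong_neutral)
    show "((\<lambda>(i, j). y i j) has_sum 1) {(i, j). i \<le> j}"
      using assms(1) by (simp add: is_state_def)
  qed (use assms(2) in \<open>auto simp: image_iff le_less\<close>)
  then have "((\<lambda>i. y i i) has_sum 1) UNIV"
    by (subst (asm) has_sum_reindex) (auto simp: inj_on_def comp_def)
  then show ?thesis by (rule has_sum_imp_sums)
qed

text \<open>Summation by parts. A service moves mass from \<open>(Suc i, j)\<close> to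
  \<open>(i, j)\<close>, an arrival from \<open>(i, j)\<close> to \<open>(Suc i, Suc j)\<close>. The
  arrival gains therefore stop at column \<open>J - 1\<close> while the losses include column
  \<open>J\<close>; the difference contains the flow out of the truncation.\<close>

lemma fluid_rhs_weighted_sum:
  fixes c :: "nat \<Rightarrow> real"
  shows "(\<Sum>j\<le>J. \<Sum>i\<le>j. c i * fluid_rhs lam y i j) =
    (\<Sum>j\<le>J. \<Sum>i<j. (c i - c (Suc i)) * y (Suc i) j)
    + lam * (\<Sum>j<J. \<Sum>i\<le>j. c (Suc i) * assign_prob y i j)
    - lam * (\<Sum>j\<le>J. \<Sum>i\<le>j. c i * assign_prob y i j)"
proof -
  let ?p = "assign_prob y"
  have inner: "(\<Sum>i\<le>j. c i * fluid_rhs lam y i j) =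
     (\<Sum>i<j. (c i - c (Suc i)) * y (Suc i) j)
     + lam * (\<Sum>i<j. c (Suc i) * ?p i (j - 1)) - lam * (\<Sum>i\<le>j. c i * ?p i j)" for j
  proof -
    have 1: "(\<Sum>i\<le>j. c i * (if i < j then y (i + 1) j else 0)) = (\<Sum>i<j. c i * y (Suc i) j)"
      unfolding lessThan_Suc_atMost[symmetric] sum.lessThan_Suc
      by (auto intro!: sum.cong)
    have 2: "(\<Sum>i\<le>j. c i * (if i > 0 then y i j else 0)) = (\<Sum>i<j. c (Suc i) * y (Suc i) j)"
      unfolding lessThan_Suc_atMost[symmetric] sum.lessThan_Suc_shift
      by (auto intro!: sum.cong)
    have 3: "(\<Sum>i\<le>j. c i * (if i > 0 then lam * ?p (i - 1) (j - 1) else 0)) =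
        lam * (\<Sum>i<j. c (Suc i) * ?p i (j - 1))"
      unfolding lessThan_Suc_atMost[symmetric] sum.lessThan_Suc_shift
      by (auto intro!: sum.cong simp: sum_distrib_left)
    have 4: "(\<Sum>i\<le>j. c i * (lam * ?p i j)) = lam * (\<Sum>i\<le>j. c i * ?p i j)"
      by (auto intro!: sum.cong simp: sum_distrib_left)
    show ?thesis
      unfolding fluid_rhs_def distrib_left right_diff_distrib sum.distrib sum_subtractf 1 2 3 4
        left_diff_distrib
      by simp
  qed
  \<comment> \<open>The inner sum is empty for \<open>j = 0\<close>, which makes the truncated
    subtraction \<open>j - 1\<close> harmless.\<close>
  have 5: "(\<Sum>j\<le>J. \<Sum>i<j. c (Suc i) * ?p i (j - 1)) = (\<Sum>j<J. \<Sum>i\<le>j. c (Suc i) * ?p i j)"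
    unfolding lessThan_Suc_atMost[symmetric] sum.lessThan_Suc_shift
    by (simp only: lessThan_0 sum.empty diff_Suc_1 lessThan_Suc_atMost add_0)
  show ?thesis
    unfolding inner sum.distrib sum_subtractf sum_distrib_left[symmetric] 5 by simp
qed

lemma sum_assign_prob_weighted:
  assumes "finite A"
  shows "(\<Sum>j\<in>A. \<Sum>i\<le>j. c i * assign_prob y i j) =
    (if min_est y \<in> A then \<Sum>i\<le>min_est y. c i * assign_prob y i (min_est y) else 0)"
proof -
  have "(\<Sum>j\<in>A. \<Sum>i\<le>j. c i * assign_prob y i j) =
     (\<Sum>j\<in>A. if min_est y = j then \<Sum>i\<le>min_est y. c i * assign_prob y i (min_est y) else 0)"
    by (rule sum.cong) (auto simp: assign_prob_def)
  also have "\<dots> = (if min_est y \<in> A then \<Sum>i\<le>min_est y. c i * assign_prob y i (min_est y) else 0)"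
    using assms by (simp add: sum.delta')
  finally show ?thesis .
qed

subsection \<open>Truncated functionals over one cycle\<close>

text \<open>A single update cycle in local time \<open>[0, T]\<close>, with the left limits as values at \<open>T\<close>.\<close>

locale fluid_cycle =
  fixes lam T :: real and z :: "real \<Rightarrow> nat \<Rightarrow> nat \<Rightarrow> real" and D :: "real set"
  assumes lam_pos: "0 < lam" and T_pos: "0 < T"
    and continuous_z: "i \<le> j \<Longrightarrow> continuous_on {0..T} (\<lambda>t. z t i j)"
    and finite_exceptions: "c < T \<Longrightarrow> finite (D \<inter> {0..c})"
    and state_z: "0 \<le> t \<Longrightarrow> t < T \<Longrightarrow> is_state (z t)"
    and z_init: "i < j \<Longrightarrow> z 0 i j = 0"
    and deriv_z: "0 < t \<Longrightarrow> t < T \<Longrightarrow> t \<notin> D \<Longrightarrow> i \<le> j \<Longrightarrow>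
      ((\<lambda>s. z s i j) has_real_derivative fluid_rhs lam (z t) i j) (at t)"
    and load: "lam * T < 1 - lam"
begin

lemma nondecreasing:
  assumes "0 \<le> a" "a \<le> b" "b \<le> T" "continuous_on {a..b} f"
    and "\<And>t. a < t \<Longrightarrow> t < b \<Longrightarrow> t \<notin> D \<Longrightarrow> \<exists>d\<ge>0. (f has_real_derivative d) (at t)"
  shows "f a \<le> f b"
proof (rule nondecreasing_except[OF assms(2,4)])
  show "finite (D \<inter> {a..c})" if "c < b" for c
    using finite_exceptions[of c] that assms by (auto elim: finite_subset[rotated])
qed (use assms in auto)

lemma constant_between:
  assumes "0 \<le> a" "a \<le> b" "b \<le> T" "continuous_on {a..b} f"
    and "\<And>t. a < t \<Longrightarrow> t < b \<Longrightarrow> t \<notin> D \<Longrightarrow> (f has_real_derivative 0) (at t)"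
  shows "f b = f a"
proof -
  have "f a \<le> f b"
    by (rule nondecreasing[OF assms(1-4)]) (use assms(5) in blast)
  moreover have "- f a \<le> - f b"
    by (rule nondecreasing[OF assms(1-3)])
       (use assms(4,5) in \<open>auto intro!: continuous_intros exI[of _ 0] derivative_eq_intros\<close>)
  ultimately show ?thesis by simp
qed

text \<open>All functionals are truncated to estimates at most \<open>J\<close>, which keeps them finite sums.\<close>

definition wsum :: "(nat \<Rightarrow> real) \<Rightarrow> nat \<Rightarrow> real \<Rightarrow> real" where
  "wsum c J t = (\<Sum>j\<le>J. \<Sum>i\<le>j. c i * z t i j)"

lemma continuous_wsum: "0 \<le> a \<Longrightarrow> b \<le> T \<Longrightarrow> continuous_on {a..b} (wsum c J)"
  unfolding wsum_def
  by (intro continuous_intros) (auto intro: continuous_on_subset[OF continuous_z])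

text \<open>At \<open>t = T\<close> the path takes a left limit of states, which is not assumed to
  be a state; only the closed condition of nonnegativity is inherited.\<close>

lemma z_nonneg:
  assumes "0 \<le> t" "t \<le> T" "i \<le> j"
  shows "0 \<le> z t i j"
proof (cases "t = T")
  case True
  have "((\<lambda>t. z t i j) \<longlongrightarrow> z T i j) (at_left T)"
    using continuous_z[OF \<open>i \<le> j\<close>] T_pos by (rule continuous_on_Icc_at_leftD)
  then show ?thesis unfolding True
    by (rule tendsto_lowerbound)
       (use T_pos state_z in \<open>auto simp: eventually_at_left_field is_state_def intro!: exI[of _ 0]\<close>)
qed (use state_z[of t] assms in \<open>auto simp: is_state_def\<close>)

lemma wsum_mono:
  assumes "0 \<le> t" "t \<le> T" "\<And>i. c i \<le> d i"
  shows "wsum c J t \<le> wsum d J t"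
  unfolding wsum_def
  by (intro sum_mono mult_right_mono assms z_nonneg) auto

lemma wsum_nonneg:
  assumes "0 \<le> t" "t \<le> T" "\<And>i. 0 \<le> c i"
  shows "0 \<le> wsum c J t"
  unfolding wsum_def
  by (intro sum_nonneg mult_nonneg_nonneg assms z_nonneg) auto

lemma wsum_add: "wsum (\<lambda>i. c i + d i) J t = wsum c J t + wsum d J t"
  by (simp add: wsum_def distrib_right sum.distrib)

lemma wsum_minus: "wsum (\<lambda>i. - c i) J t = - wsum c J t"
  by (simp add: wsum_def sum_negf)

lemma wsum_zero: "wsum (\<lambda>i. 0) J t = 0"
  by (simp add: wsum_def)

lemma wsum_init: "wsum c J 0 = (\<Sum>i\<le>J. c i * z 0 i i)"
proof -
  have "(\<Sum>i\<le>j. c i * z 0 i j) = c j * z 0 j j" for j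
    by (subst sum.remove[of _ j]) (auto intro!: sum.neutral z_init)
  then show ?thesis by (simp add: wsum_def)
qed

lemma wsum_deriv_gen:
  assumes "0 < t" "t < T" "t \<notin> D"
  shows "(wsum c J has_real_derivative
     wsum (\<lambda>i. if i = 0 then 0 else c (i - 1) - c i) J t
     + lam * (\<Sum>j<J. \<Sum>i\<le>j. c (Suc i) * assign_prob (z t) i j)
     - lam * (\<Sum>j\<le>J. \<Sum>i\<le>j. c i * assign_prob (z t) i j)) (at t)"
proof -
  have "(\<Sum>i\<le>j. (if i = 0 then 0 else c (i - 1) - c i) * z t i j) =
      (\<Sum>i<j. (c i - c (Suc i)) * z t (Suc i) j)" for j
    unfolding lessThan_Suc_atMost[symmetric] sum.lessThan_Suc_shift
    by (auto intro!: sum.cong)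
  then have eq: "wsum (\<lambda>i. if i = 0 then 0 else c (i - 1) - c i) J t =
      (\<Sum>j\<le>J. \<Sum>i<j. (c i - c (Suc i)) * z t (Suc i) j)"
    by (simp add: wsum_def)
  have "(wsum c J has_real_derivative (\<Sum>j\<le>J. \<Sum>i\<le>j. c i * fluid_rhs lam (z t) i j)) (at t)"
    unfolding wsum_def by (intro DERIV_sum DERIV_cmult deriv_z assms) auto
  then show ?thesis unfolding eq fluid_rhs_weighted_sum .
qed

text \<open>When \<open>m < J\<close>, both arrival sums of \<open>wsum_deriv_gen\<close> contain
  the column \<open>m\<close>, so nothing leaves the truncation and an arrival at queue length
  \<open>i\<close> simply changes the weight by \<open>c (Suc i) - c i\<close>.\<close>

lemma wsum_deriv:
  assumes "0 < t" "t < T" "t \<notin> D" and m: "m = min_est (z t)" "m < J"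
  shows "(wsum c J has_real_derivative
     wsum (\<lambda>i. if i = 0 then 0 else c (i - 1) - c i) J t
     + lam * (\<Sum>i\<le>m. (c (Suc i) - c i) * assign_prob (z t) i m)) (at t)"
  using wsum_deriv_gen[OF assms(1-3), of c J] m
  by (simp add: sum_assign_prob_weighted left_diff_distrib right_diff_distrib sum_subtractf algebra_simps)

text \<open>Services preserve the estimate, so mass leaves the columns up to \<open>J\<close> only
  through arrivals in column \<open>J\<close>, that is while \<open>min_est\<close> equals
  \<open>J\<close>, and then at rate \<open>lam\<close>.\<close>

lemma mass_lower_bound:
  assumes "0 \<le> t" "t \<le> T"
  shows "wsum (\<lambda>_. 1) J 0 - lam * t \<le> wsum (\<lambda>_. 1) J t"
proof -
  let ?f = "\<lambda>s. wsum (\<lambda>_. 1) J s + lam * s"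
  have "?f 0 \<le> ?f t"
  proof (rule nondecreasing[of 0 t ?f])
    fix s assume s: "0 < s" "s < t" "s \<notin> D"
    have st: "is_state (z s)" using state_z s assms by simp
    have eq: "(\<lambda>i::nat. if i = 0 then 0 else (1::real) - 1) = (\<lambda>_. 0)" by auto
    have "(wsum (\<lambda>_. 1) J has_real_derivative
      lam * (if min_est (z s) < J then 1 else 0) - lam * (if min_est (z s) \<le> J then 1 else 0)) (at s)"
      using wsum_deriv_gen[of s "\<lambda>_. 1" J] s assms
        sum_assign_prob_weighted[of "{..<J}" "\<lambda>_. 1" "z s"]
        sum_assign_prob_weighted[of "{..J}" "\<lambda>_. 1" "z s"]
      unfolding eq wsum_zero by (simp add: sum_assign_prob[OF st])
    from DERIV_add[OF this DERIV_cmult_Id[of lam]]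
    have "(?f has_real_derivative lam * (if min_est (z s) < J then 1 else 0)
        - lam * (if min_est (z s) \<le> J then 1 else 0) + lam) (at s)" .
    moreover have "0 \<le> lam * (if min_est (z s) < J then 1 else 0)
        - lam * (if min_est (z s) \<le> J then 1 else 0) + lam"
      using lam_pos by simp
    ultimately show "\<exists>d\<ge>0. (?f has_real_derivative d) (at s)" by blast
  qed (use assms in \<open>auto intro!: continuous_intros continuous_wsum\<close>)
  then show ?thesis by simp
qed

text \<open>Before the mass on estimates at most \<open>J\<close> can be exhausted, one of these
  estimates still carries mass. The case \<open>J = 0\<close> says that idle servers known to be
  idle last at least for the time \<open>z 0 0 0 / lam\<close>.\<close>

lemma min_est_le:
  assumes "0 \<le> t" "t < T" "lam * t < wsum (\<lambda>_. 1) J 0"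
  shows "min_est (z t) \<le> J"
proof -
  have "0 < wsum (\<lambda>_. 1) J t"
    using mass_lower_bound[of t J] assms by simp
  moreover have "wsum (\<lambda>_. 1) J t = (\<Sum>j\<le>J. est_frac (z t) j)"
    by (simp add: wsum_def est_frac_def atLeast0AtMost)
  ultimately obtain j where "j \<le> J" "0 < est_frac (z t) j"
    by (metis (no_types, lifting) atMost_iff not_less sum_nonpos)
  then show ?thesis
    unfolding min_est_def by (metis (mono_tags, lifting) Least_le order_trans)
qed

lemma min_est_zero:
  assumes "0 \<le> t" "t < T" "lam * t < z 0 0 0"
  shows "min_est (z t) = 0"
  using min_est_le[of t 0] assms by (simp add: wsum_def)

section \<open>Functionals of the queue length\<close>

definition mass :: "nat \<Rightarrow> real \<Rightarrow> real" where "mass = wsum (\<lambda>i. 1)"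
definition idle :: "nat \<Rightarrow> real \<Rightarrow> real" where "idle = wsum (\<lambda>i. if i = 0 then 1 else 0)"
definition single :: "nat \<Rightarrow> real \<Rightarrow> real" where "single = wsum (\<lambda>i. if i = 1 then 1 else 0)"
definition busy :: "nat \<Rightarrow> real \<Rightarrow> real" where "busy = wsum (\<lambda>i. if 1 \<le> i then 1 else 0)"
definition busy2 :: "nat \<Rightarrow> real \<Rightarrow> real" where "busy2 = wsum (\<lambda>i. if 2 \<le> i then 1 else 0)"
definition queue :: "nat \<Rightarrow> real \<Rightarrow> real" where "queue = wsum real"
text \<open>Natural subtraction gives the weight \<open>max (i - 1) 0\<close> in the reals: the jobs
  waiting behind the one in service.\<close>

definition excess :: "nat \<Rightarrow> real \<Rightarrow> real" where "excess = wsum (\<lambda>i. real (i - 1))"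

lemmas functionals_def = mass_def idle_def single_def busy_def busy2_def queue_def excess_def

lemma mass_eq: "mass J t = idle J t + busy J t"
  unfolding functionals_def wsum_add[symmetric] by (rule arg_cong[where f = "\<lambda>c. wsum c J t"]) auto

lemma busy_eq: "busy J t = single J t + busy2 J t"
  unfolding functionals_def wsum_add[symmetric] by (rule arg_cong[where f = "\<lambda>c. wsum c J t"]) auto

lemma queue_eq: "queue J t = excess J t + busy J t"
  unfolding functionals_def wsum_add[symmetric] by (rule arg_cong[where f = "\<lambda>c. wsum c J t"]) auto

lemma idle_start: "idle J 0 = z 0 0 0"
  by (simp add: idle_def wsum_init if_distrib[of "\<lambda>x. x * _"] sum.delta cong: if_cong)

end

text \<open>As \<open>m(t)\<close> stays below \<open>J\<close>, no mass leaves the truncation and it obeys a closed system.\<close>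

locale truncated_cycle = fluid_cycle +
  fixes J :: nat
  assumes min_est_less: "0 < t \<Longrightarrow> t < T \<Longrightarrow> min_est (z t) < J"
begin

lemma continuous_functionals:
  assumes "0 \<le> a" "b \<le> T"
  shows "continuous_on {a..b} (mass J)" "continuous_on {a..b} (busy J)" "continuous_on {a..b} (busy2 J)"
    "continuous_on {a..b} (queue J)" "continuous_on {a..b} (excess J)"
  unfolding functionals_def using assms by (auto intro: continuous_wsum)

lemma functionals_nonneg:
  assumes "0 \<le> t" "t \<le> T"
  shows "0 \<le> idle J t" "0 \<le> single J t" "0 \<le> busy J t" "0 \<le> busy2 J t" "0 \<le> excess J t"
  unfolding functionals_def using assms by (auto intro!: wsum_nonneg)

text \<open>The assignment rule enters the equations for \<open>busy\<close> and
  \<open>excess\<close> only through this number.\<close>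

definition idle_prob :: "real \<Rightarrow> real" where
  "idle_prob t = assign_prob (z t) 0 (min_est (z t))"

lemma sum_prob:
  assumes "0 < t" "t < T"
  shows "(\<Sum>i\<le>min_est (z t). assign_prob (z t) i (min_est (z t))) = 1"
  using sum_assign_prob[of "z t"] state_z assms by simp

lemma idle_prob_nonneg: "0 < t \<Longrightarrow> t < T \<Longrightarrow> 0 \<le> idle_prob t"
  unfolding idle_prob_def by (intro assign_prob_nonneg state_z) auto

lemma idle_prob_one: "0 < t \<Longrightarrow> t < T \<Longrightarrow> min_est (z t) = 0 \<Longrightarrow> idle_prob t = 1"
  using sum_prob[of t] by (simp add: idle_prob_def)

section \<open>Differential equations of the truncated functionals\<close>

context
  fixes t assumes t: "0 < t" "t < T" "t \<notin> D"
begin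

lemma deriv_mass: "(mass J has_real_derivative 0) (at t)"
proof -
  have eq: "(\<lambda>i::nat. if i = 0 then 0 else (1::real) - 1) = (\<lambda>_. 0)" by auto
  show ?thesis
    using wsum_deriv[OF t refl min_est_less[OF t(1,2)], of "\<lambda>_. 1"] unfolding mass_def eq wsum_zero
    by simp
qed

lemma deriv_queue: "(queue J has_real_derivative lam - busy J t) (at t)"
proof -
  have eq: "(\<lambda>i. if i = 0 then 0 else real (i - 1) - real i) = (\<lambda>i. - (if 1 \<le> i then 1 else 0))"
    by (auto simp: of_nat_diff)
  show ?thesis
    using wsum_deriv[OF t refl min_est_less[OF t(1,2)], of real] sum_prob[of t] t
    unfolding queue_def eq wsum_minus busy_def by simp
qed

text \<open>A server leaves the busy class only by finishing its single job and enters it only by an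
  arrival while idle.\<close>

lemma deriv_busy: "(busy J has_real_derivative lam * idle_prob t - single J t) (at t)"
proof -
  have eq: "(\<lambda>i::nat. if i = 0 then 0 else (if 1 \<le> i - 1 then 1 else 0) - (if 1 \<le> i then 1 else 0)) =
      (\<lambda>i. - (if i = 1 then 1 else (0::real)))"
    by (rule ext) (auto split: if_splits)
  have "(\<Sum>i\<le>m. ((if 1 \<le> Suc i then 1 else 0) - (if 1 \<le> i then 1 else 0)) * p i) = (p 0 :: real)"
    for m and p :: "nat \<Rightarrow> real"
    by (subst sum.remove[of _ 0]) (auto intro!: sum.neutral)
  then show ?thesis
    using wsum_deriv[OF t refl min_est_less[OF t(1,2)], of "\<lambda>i. if 1 \<le> i then 1 else 0"]
    unfolding busy_def eq wsum_minus single_def idle_prob_def by simp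
qed

lemma deriv_excess: "(excess J has_real_derivative lam * (1 - idle_prob t) - busy2 J t) (at t)"
proof -
  have "excess J = (\<lambda>t. queue J t - busy J t)" by (simp add: queue_eq)
  with DERIV_diff[OF deriv_queue deriv_busy] show ?thesis
    using busy_eq[of J t] by (simp add: algebra_simps)
qed

text \<open>With minimal estimate zero every arrival turns length 0 into length 1, so the class of
  length at least two only loses mass through services at length two.\<close>

lemma deriv_busy2:
  assumes "min_est (z t) = 0"
  obtains d where "d \<le> 0" "(busy2 J has_real_derivative d) (at t)"
proof
  let ?c = "\<lambda>i::nat. if i = 0 then 0 else (if 2 \<le> i - 1 then 1 else 0) - (if 2 \<le> i then 1 else 0 :: real)"
  show "(busy2 J has_real_derivative wsum ?c J t) (at t)"
    using wsum_deriv[OF t refl min_est_less[OF t(1,2)], of "\<lambda>i. if 2 \<le> i then 1 else 0"] assms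
    unfolding busy2_def by simp
  have "wsum ?c J t \<le> wsum (\<lambda>i. 0) J t"
    using t by (intro wsum_mono) auto
  then show "wsum ?c J t \<le> 0"
    by (simp add: wsum_zero)
qed

end

section \<open>Comparison estimates between two times of a cycle\<close>

lemma mass_const: "0 \<le> t \<Longrightarrow> t \<le> T \<Longrightarrow> mass J t = mass J 0"
  by (rule constant_between) (auto intro: continuous_functionals deriv_mass)

text \<open>Gronwall's argument: from \<open>single \<le> busy\<close> the derivative of
  \<open>busy - \<kappa>\<close> is at least its negative, so its product with \<open>exp t\<close>
  does not decrease. The bound is used with \<open>\<kappa> = lam\<close> while idle servers are
  surely recognised, and with \<open>\<kappa> = 0\<close> afterwards.\<close>

lemma busy_lower:
  assumes ab: "0 \<le> a" "a \<le> b" "b \<le> T"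
    and p: "\<And>t. a < t \<Longrightarrow> t < b \<Longrightarrow> \<kappa> \<le> lam * idle_prob t"
  shows "(busy J a - \<kappa>) * exp (a - b) \<le> busy J b - \<kappa>"
proof -
  have "(busy J a - \<kappa>) * exp a \<le> (busy J b - \<kappa>) * exp b"
  proof (rule nondecreasing[OF ab])
    fix t assume t: "a < t" "t < b" "t \<notin> D"
    have "((\<lambda>t. (busy J t - \<kappa>) * exp t) has_real_derivative
        (lam * idle_prob t - single J t) * exp t + (busy J t - \<kappa>) * exp t) (at t)"
      using t ab by (auto intro!: derivative_eq_intros deriv_busy)
    moreover have "single J t \<le> busy J t"
      using functionals_nonneg[of t] busy_eq[of J t] t ab by simp
    ultimately show "\<exists>d\<ge>0. ((\<lambda>t. (busy J t - \<kappa>) * exp t) has_real_derivative d) (at t)"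
      using p[of t] t by (intro exI conjI) (auto simp flip: distrib_right)
  qed (use ab in \<open>auto intro!: continuous_intros continuous_functionals\<close>)
  then show ?thesis
    by (simp add: exp_diff field_simps)
qed

text \<open>Integrates \<open>queue' = lam - busy\<close> after inserting the exponential lower
  bound for \<open>busy\<close>; \<open>?f\<close> is an antiderivative of the resulting bound minus
  the queue.\<close>

lemma queue_upper:
  assumes ab: "0 \<le> a" "a \<le> b" "b \<le> T"
    and p: "\<And>t. a < t \<Longrightarrow> t < b \<Longrightarrow> \<kappa> \<le> lam * idle_prob t"
  shows "queue J b \<le> queue J a + (lam - \<kappa>) * (b - a) - (busy J a - \<kappa>) * (1 - exp (a - b))"
proof -
  let ?f = "\<lambda>t. (lam - \<kappa>) * (t - a) + (busy J a - \<kappa>) * exp (a - t) - queue J t"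
  have "?f a \<le> ?f b"
  proof (rule nondecreasing[OF ab])
    fix t assume t: "a < t" "t < b" "t \<notin> D"
    have "(?f has_real_derivative
        (lam - \<kappa>) - (busy J a - \<kappa>) * exp (a - t) - (lam - busy J t)) (at t)"
      using t ab by (auto intro!: derivative_eq_intros deriv_queue)
    moreover have "(busy J a - \<kappa>) * exp (a - t) \<le> busy J t - \<kappa>"
      using t ab p by (intro busy_lower) auto
    ultimately show "\<exists>d\<ge>0. (?f has_real_derivative d) (at t)"
      by (intro exI conjI) auto
  qed (use ab in \<open>auto intro!: continuous_intros continuous_functionals\<close>)
  then show ?thesis by (simp add: algebra_simps)
qed

text \<open>Only arrivals at busy servers raise the excess, and their rate is at most
  \<open>lam - \<kappa>\<close>.\<close>

lemma excess_upper:
  assumes ab: "0 \<le> a" "a \<le> b" "b \<le> T"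
    and p: "\<And>t. a < t \<Longrightarrow> t < b \<Longrightarrow> \<kappa> \<le> lam * idle_prob t"
  shows "excess J b \<le> excess J a + (lam - \<kappa>) * (b - a)"
proof -
  have "(lam - \<kappa>) * a - excess J a \<le> (lam - \<kappa>) * b - excess J b"
  proof (rule nondecreasing[OF ab])
    fix t assume t: "a < t" "t < b" "t \<notin> D"
    have "((\<lambda>t. (lam - \<kappa>) * t - excess J t) has_real_derivative
        (lam - \<kappa>) - (lam * (1 - idle_prob t) - busy2 J t)) (at t)"
      using t ab by (auto intro!: derivative_eq_intros deriv_excess)
    moreover have "0 \<le> (lam - \<kappa>) - (lam * (1 - idle_prob t) - busy2 J t)"
      using p[of t] functionals_nonneg[of t] t ab by (simp add: algebra_simps)
    ultimately show "\<exists>d\<ge>0. ((\<lambda>t. (lam - \<kappa>) * t - excess J t) has_real_derivative d) (at t)"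
      by blast
  qed (use ab in \<open>auto intro!: continuous_intros continuous_functionals\<close>)
  then show ?thesis by (simp add: algebra_simps)
qed

section \<open>Cycles that start with too few idle servers\<close>

lemma early_idle_prob:
  assumes "0 < t" "t < T" "lam * t < z 0 0 0"
  shows "lam \<le> lam * idle_prob t"
  using idle_prob_one min_est_zero assms by simp

text \<open>The cycle is split at the time \<tau> up to which the initial idle servers suffice for
  all arrivals. The two bounds \<open>A'\<close> and \<open>B\<close> treat the two possible values
  of the final maximum; the initial maximum is \<open>busy J 0\<close> because few idle servers mean
  many busy ones.\<close>

lemma bad_cycle:
  assumes bad: "z 0 0 0 < lam * T" and big: "lam + lam * T \<le> mass J 0"
  shows "excess J T + max (busy J T) lam
    \<le> excess J 0 + max (busy J 0) lam - (mass J 0 - lam - lam * T) * (1 - exp (- T))"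
proof -
  define \<tau> where "\<tau> = z 0 0 0 / lam"
  define \<eta> where "\<eta> = mass J 0 - lam - lam * T"
  define u where "u = T - \<tau>"
  have x: "z 0 0 0 = lam * \<tau>" using lam_pos by (simp add: \<tau>_def)
  have \<tau>: "0 \<le> \<tau>" "\<tau> \<le> T"
    using bad z_nonneg[of 0 0 0] T_pos lam_pos by (auto simp: \<tau>_def field_simps)
  have u: "0 \<le> u" "u \<le> T" using \<tau> by (auto simp: u_def)
  have p1: "lam \<le> lam * idle_prob t" if "0 < t" "t < \<tau>" for t
    using that \<tau> lam_pos by (intro early_idle_prob) (auto simp: x)
  have p2: "0 \<le> lam * idle_prob t" if "\<tau> < t" "t < T" for t
    using that \<tau> lam_pos idle_prob_nonneg[of t] by simp
  have busy0: "busy J 0 = lam + \<eta> + lam * u"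
    using mass_eq[of J 0] idle_start[of J] by (simp add: \<eta>_def u_def x algebra_simps)
  have eT: "exp (- T) \<le> exp (- u)" "exp (- T) \<le> 1" "0 \<le> \<eta>"
    using u T_pos big by (auto simp: \<eta>_def)
  have "excess J T \<le> excess J 0 + lam * u"
    using excess_upper[of 0 \<tau> lam] excess_upper[of \<tau> T 0] p1 p2 \<tau> by (simp add: u_def)
  \<comment> \<open>The growth \<open>lam * u\<close> of the excess in the second phase is paid for
    by the surplus of \<open>busy J 0\<close> over \<open>lam + \<eta>\<close>.\<close>
  then have A: "excess J T + lam \<le> excess J 0 + busy J 0 - \<eta>"
    using busy0 by simp
  have "\<eta> * (1 - exp (- T)) \<le> \<eta>"
    using eT by (simp add: mult_left_le)
  with A have A': "excess J T + lam \<le> excess J 0 + busy J 0 - \<eta> * (1 - exp (- T))" by simp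
  have q1: "queue J \<tau> \<le> queue J 0 - (busy J 0 - lam) * (1 - exp (- \<tau>))"
    using queue_upper[of 0 \<tau> lam] p1 \<tau> by simp
  have s1: "lam + (busy J 0 - lam) * exp (- \<tau>) \<le> busy J \<tau>"
    using busy_lower[of 0 \<tau> lam] p1 \<tau> by simp
  have q2: "queue J T \<le> queue J \<tau> + lam * u - busy J \<tau> * (1 - exp (- u))"
    using queue_upper[of \<tau> T 0] p2 \<tau> by (simp add: u_def)
  have "(lam + (busy J 0 - lam) * exp (- \<tau>)) * (1 - exp (- u)) \<le> busy J \<tau> * (1 - exp (- u))"
    using s1 u by (intro mult_right_mono) auto
  \<comment> \<open>The two phases fit together: the exponential decay from \<tau> on continues that
    of the first phase, so the surplus \<open>busy J 0 - lam\<close> is multiplied by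
    \<open>1 - exp (- T)\<close> in total.\<close>
  with q1 q2 have "queue J T \<le> queue J 0 - (busy J 0 - lam) * (1 - exp (- \<tau>)) + lam * u
      - (lam + (busy J 0 - lam) * exp (- \<tau>)) * (1 - exp (- u))"
    by linarith
  also have "\<dots> = queue J 0 + lam * u - lam * (1 - exp (- u)) - (busy J 0 - lam) * (1 - exp (- \<tau>) * exp (- u))"
    by (simp add: algebra_simps)
  also have "exp (- \<tau>) * exp (- u) = exp (- T)"
    by (simp add: u_def flip: exp_add)
  also have "queue J 0 + lam * u - lam * (1 - exp (- u)) - (busy J 0 - lam) * (1 - exp (- T))
      = queue J 0 - \<eta> * (1 - exp (- T)) - lam * (1 - exp (- u) - u * exp (- T))"
    by (simp add: busy0 algebra_simps)
  also have "\<dots> \<le> queue J 0 - \<eta> * (1 - exp (- T))"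
  proof -
    \<comment> \<open>It remains that \<open>1 - exp (- u) - u * exp (- T)\<close> is nonnegative.
      Since \<open>u \<le> T\<close>, it is at least \<open>1 - (1 + u) * exp (- u)\<close>, and
      \<open>1 + u \<le> exp u\<close>.\<close>
    have "(1 + u) * exp (- u) \<le> exp u * exp (- u)"
      by (intro mult_right_mono exp_ge_add_one_self) auto
    then have "(1 + u) * exp (- u) \<le> 1" by (simp flip: exp_add)
    moreover have "u * exp (- T) \<le> u * exp (- u)"
      using u eT by (intro mult_left_mono) auto
    ultimately have "0 \<le> 1 - exp (- u) - u * exp (- T)" by (simp add: algebra_simps)
    then show ?thesis using lam_pos by simp
  qed
  finally have B: "excess J T + busy J T \<le> excess J 0 + busy J 0 - \<eta> * (1 - exp (- T))"
    by (simp add: queue_eq)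
  show ?thesis using A' B unfolding \<eta>_def by linarith
qed

section \<open>Cycles that start with enough idle servers\<close>

context
  assumes good: "lam * T \<le> z 0 0 0"
begin

lemma good_min_est:
  assumes "0 < t" "t < T" shows "min_est (z t) = 0"
proof -
  have "lam * t < lam * T" using assms lam_pos by simp
  then show ?thesis using min_est_zero[of t] good assms by simp
qed

lemma good_prob: "0 < t \<Longrightarrow> t < T \<Longrightarrow> idle_prob t = 1"
  using good_min_est idle_prob_one by simp

lemma good_excess: "0 \<le> a \<Longrightarrow> a \<le> b \<Longrightarrow> b \<le> T \<Longrightarrow> excess J b \<le> excess J a"
  using excess_upper[of a b lam] good_prob by simp

lemma good_queue:
  assumes "0 \<le> a" "a \<le> b" "b \<le> T" "lam \<le> busy J a"
  shows "queue J b \<le> queue J a"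
proof -
  have "queue J b \<le> queue J a - (busy J a - lam) * (1 - exp (a - b))"
    using queue_upper[of a b lam] good_prob assms by simp
  moreover have "0 \<le> (busy J a - lam) * (1 - exp (a - b))"
    using assms by simp
  ultimately show ?thesis by linarith
qed

text \<open>Below the level \<open>lam\<close> of \<open>busy\<close> only the excess matters, and
  it does not increase; above this level the queue does not increase. If \<open>busy\<close> starts
  below \<open>lam\<close> and ends above it, the two arguments are joined at a crossing
  time.\<close>

lemma good_cycle: "excess J T + max (busy J T) lam \<le> excess J 0 + max (busy J 0) lam"
proof (cases "busy J T \<le> lam")
  case True
  then show ?thesis using good_excess[of 0 T] T_pos by simp
next
  case F: False
  show ?thesis
  proof (cases "lam \<le> busy J 0")
    case True
    then show ?thesis using good_queue[of 0 T] T_pos F by (simp add: queue_eq)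
  next
    case False
    then obtain s where s: "0 \<le> s" "s \<le> T" "busy J s = lam"
      using IVT'[of "busy J" 0 lam T] F T_pos continuous_functionals(2)[of 0 T] by auto
    then show ?thesis using good_queue[of s T] good_excess[of 0 s] F False by (simp add: queue_eq)
  qed
qed

lemma good_busy2:
  assumes ab: "0 \<le> a" "a \<le> b" "b \<le> T"
  shows "busy2 J b \<le> busy2 J a"
proof -
  have "- busy2 J a \<le> - busy2 J b"
  proof (rule nondecreasing[OF ab])
    fix t assume t: "a < t" "t < b" "t \<notin> D"
    then obtain d where "d \<le> 0" "(busy2 J has_real_derivative d) (at t)"
      using deriv_busy2[of t] good_min_est ab by auto
    then show "\<exists>d\<ge>0. ((\<lambda>t. - busy2 J t) has_real_derivative d) (at t)"
      by (intro exI[of _ "- d"]) (auto intro: DERIV_minus)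
  qed (use ab in \<open>auto intro!: continuous_intros continuous_functionals\<close>)
  then show ?thesis by simp
qed

text \<open>The excess falls at rate \<open>busy2\<close>, which is nonincreasing and hence at least
  its final value. This turns a bounded excess into control of \<open>busy2\<close> at update
  moments.\<close>

lemma good_excess_decrease: "excess J T + T * busy2 J T \<le> excess J 0"
proof -
  let ?f = "\<lambda>t. - excess J t - busy2 J T * t"
  have "?f 0 \<le> ?f T"
  proof (rule nondecreasing[of 0 T ?f])
    fix t assume t: "0 < t" "t < T" "t \<notin> D"
    have "(?f has_real_derivative
        - (lam * (1 - idle_prob t) - busy2 J t) - busy2 J T) (at t)"
      using t by (auto intro!: derivative_eq_intros deriv_excess)
    moreover have "busy2 J T \<le> busy2 J t" using t by (intro good_busy2) auto
    ultimately show "\<exists>d\<ge>0. (?f has_real_derivative d) (at t)"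
      using good_prob[of t] t by (intro exI conjI) auto
  qed (use T_pos in \<open>auto intro!: continuous_intros continuous_functionals\<close>)
  then show ?thesis by (simp add: algebra_simps)
qed

lemma good_busy_lower: "(busy J 0 - lam) * exp (- T) \<le> busy J T - lam"
  using busy_lower[of 0 T lam] good_prob T_pos by simp

text \<open>Here \<open>busy' = lam - busy + busy2\<close>, and \<open>busy2\<close> stays below its
  initial value. Together with \<open>good_busy_lower\<close> this makes \<open>busy - lam\<close>
  contract up to the initial \<open>busy2\<close>.\<close>

lemma good_busy_upper: "busy J T - lam \<le> busy2 J 0 + (busy J 0 - lam - busy2 J 0) * exp (- T)"
proof -
  let ?f = "\<lambda>t. - (busy J t - lam - busy2 J 0) * exp t"
  have "?f 0 \<le> ?f T"
  proof (rule nondecreasing[of 0 T ?f])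
    fix t assume t: "0 < t" "t < T" "t \<notin> D"
    have "(?f has_real_derivative
        - (lam * idle_prob t - single J t) * exp t - (busy J t - lam - busy2 J 0) * exp t) (at t)"
      using t by (auto intro!: derivative_eq_intros deriv_busy simp: algebra_simps)
    also have "- (lam * idle_prob t - single J t) * exp t - (busy J t - lam - busy2 J 0) * exp t
        = (busy2 J 0 - busy2 J t) * exp t"
      using good_prob[of t] t busy_eq[of J t] by (simp add: algebra_simps)
    finally show "\<exists>d\<ge>0. (?f has_real_derivative d) (at t)"
      using good_busy2[of 0 t] t by (intro exI conjI) auto
  qed (use T_pos in \<open>auto intro!: continuous_intros continuous_functionals\<close>)
  then have "(busy J T - lam - busy2 J 0) * exp T \<le> busy J 0 - lam - busy2 J 0"
    by (simp add: algebra_simps)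
  then have "busy J T - lam - busy2 J 0 \<le> (busy J 0 - lam - busy2 J 0) * exp (- T)"
    by (simp add: exp_minus field_simps)
  then show ?thesis by simp
qed

end

end

subsection \<open>Removing the truncation\<close>

context fluid_cycle
begin

lemma wsum_swap: "wsum c J t = (\<Sum>i\<le>J. c i * (\<Sum>j=i..J. z t i j))"
proof -
  have "wsum c J t = (\<Sum>j\<le>J. \<Sum>i | i \<le> J \<and> i \<le> j. c i * z t i j)"
    unfolding wsum_def by (intro sum.cong) auto
  also have "\<dots> = (\<Sum>i\<le>J. \<Sum>j | j \<le> J \<and> i \<le> j. c i * z t i j)"
    using sum.swap_restrict[of "{..J}" "{..J}" "\<lambda>j i. c i * z t i j" "\<lambda>j i. i \<le> j"] by simp
  also have "\<dots> = (\<Sum>i\<le>J. c i * (\<Sum>j=i..J. z t i j))"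
    unfolding sum_distrib_left by (intro sum.cong) auto
  finally show ?thesis .
qed

lemma mass_le_1:
  assumes "0 \<le> t" "t \<le> T"
  shows "mass J t \<le> 1"
proof (cases "t = T")
  case True
  have "(mass J \<longlongrightarrow> mass J T) (at_left T)"
    using continuous_wsum[of 0 T] T_pos unfolding mass_def
    by (intro continuous_on_Icc_at_leftD[of 0]) auto
  then show ?thesis unfolding True
    by (rule tendsto_upperbound)
       (use T_pos state_partial_sum_le[OF state_z]
        in \<open>auto simp: eventually_at_left_field mass_def wsum_def intro!: exI[of _ 0]\<close>)
next
  case False
  then show ?thesis
    using state_partial_sum_le[OF state_z] assms by (simp add: mass_def wsum_def)
qed

abbreviation start :: "nat \<Rightarrow> real" where "start i \<equiv> z 0 i i"
abbreviation finish :: "nat \<Rightarrow> real" where "finish i \<equiv> queue_frac (z T) i"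

lemma start_sums: "start sums 1"
  using diagonal_state_sums[OF state_z[of 0]] T_pos z_init by simp

text \<open>At \<open>T\<close> there is only a limit of states, so summability of a column is
  derived from the uniform bound on the truncated masses; without it \<open>queue_frac\<close> could
  be the default value of an infinite sum.\<close>

lemma column_tendsto: "(\<lambda>J. \<Sum>j=i..J. z T i j) \<longlonglongrightarrow> finish i"
proof -
  have nn: "0 \<le> z T i l" if "l \<in> {i..}" for l
    using z_nonneg T_pos that by simp
  have bound: "sum (z T i) F \<le> 1" if "F \<subseteq> {i..}" "finite F" for F
  proof -
    \<comment> \<open>Inserting \<open>i\<close> covers the empty set and ensures that column
      \<open>i\<close> occurs in the truncated mass.\<close>
    define J where "J = Max (insert i F)"
    have FJ: "F \<subseteq> {i..J}" "i \<le> J" using that by (auto simp: J_def)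
    have "sum (z T i) F \<le> (\<Sum>j=i..J. z T i j)"
      using FJ z_nonneg T_pos by (intro sum_mono2) auto
    also have "\<dots> \<le> (\<Sum>i\<le>J. \<Sum>j=i..J. z T i j)"
      using FJ z_nonneg T_pos
      by (intro member_le_sum[of i "{..J}" "\<lambda>i. \<Sum>j=i..J. z T i j"]) (auto intro!: sum_nonneg)
    also have "\<dots> = mass J T" by (simp add: mass_def wsum_swap)
    also have "\<dots> \<le> 1" using mass_le_1 T_pos by simp
    finally show ?thesis .
  qed
  have "z T i summable_on {i..}"
    by (rule nonneg_bdd_above_summable_on) (use nn bound in \<open>auto intro!: bdd_aboveI[of _ 1]\<close>)
  then have "(z T i has_sum finish i) {i..}"
    unfolding queue_frac_def by (rule has_sum_infsum)
  then have "((\<lambda>j. if i \<le> j then z T i j else 0) has_sum finish i) UNIV"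
    by (subst has_sum_cong_neutral[where T = "{i..}" and g = "z T i"]) auto
  then have "(\<lambda>J. \<Sum>j\<le>J. if i \<le> j then z T i j else 0) \<longlonglongrightarrow> finish i"
    using has_sum_imp_sums sums_def_le by blast
  moreover have "(\<Sum>j\<le>J. if i \<le> j then z T i j else 0) = (\<Sum>j=i..J. z T i j)" for J
    by (intro sum.mono_neutral_cong_right) auto
  ultimately show ?thesis by simp
qed

lemma finish_nonneg: "0 \<le> finish i"
  unfolding queue_frac_def by (rule infsum_nonneg) (use z_nonneg T_pos in auto)

lemma mass_start_tendsto: "(\<lambda>J. mass J 0) \<longlonglongrightarrow> 1"
  using start_sums by (simp add: mass_def wsum_init sums_def_le)

text \<open>The initial mass on estimates up to \<open>J\<close> tends to one, which exceeds the
  total arrivals \<open>lam * T\<close> of a cycle; so for large \<open>J\<close> it outlasts the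
  cycle. Passing to \<open>Suc J\<close> makes the bound on \<open>min_est\<close> strict.\<close>

lemma eventually_truncated: "\<forall>\<^sub>F J in sequentially. truncated_cycle lam T z D J"
proof -
  have "\<forall>\<^sub>F J in sequentially. lam * T < mass J 0"
    using mass_start_tendsto load lam_pos by (intro order_tendstoD(1)[of _ 1]) auto
  then have "\<forall>\<^sub>F J in sequentially. truncated_cycle lam T z D (Suc J)"
  proof eventually_elim
    case (elim J)
    show ?case
    proof unfold_locales
      fix t assume t: "0 < t" "t < T"
      then have "lam * t < lam * T" using lam_pos by simp
      then show "min_est (z t) < Suc J"
        using min_est_le[of t J] t elim by (simp add: mass_def)
    qed
  qed
  then show ?thesis by (subst (asm) eventually_sequentially_Suc)
qed

text \<open>For large \<open>J\<close> the truncated mass is conserved, so no mass escapes to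
  infinity in the left limit.\<close>

lemma mass_finish_tendsto: "(\<lambda>J. mass J T) \<longlonglongrightarrow> 1"
proof -
  have "\<forall>\<^sub>F J in sequentially. mass J 0 = mass J T"
    using eventually_truncated
  proof eventually_elim
    case (elim J)
    then interpret truncated_cycle lam T z D J .
    show ?case using mass_const[of T] T_pos by simp
  qed
  then show ?thesis by (rule Lim_transform_eventually[OF mass_start_tendsto])
qed

lemma idle_finish: "idle J T = (\<Sum>j=0..J. z T 0 j)"
  by (simp add: idle_def wsum_swap if_distrib[of "\<lambda>x. x * _"] sum.delta cong: if_cong)

lemma single_finish: "1 \<le> J \<Longrightarrow> single J T = (\<Sum>j=1..J. z T 1 j)"
  by (simp add: single_def wsum_swap if_distrib[of "\<lambda>x. x * _"] sum.delta cong: if_cong)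

lemma single_start: "1 \<le> J \<Longrightarrow> single J 0 = start 1"
  by (simp add: single_def wsum_init if_distrib[of "\<lambda>x. x * _"] sum.delta cong: if_cong)

text \<open>At the end of a cycle limits are available for the total mass and for single columns, so
  the tail classes are expressed as complements.\<close>

lemma busy_mass: "busy J t = mass J t - idle J t"
  using mass_eq by simp

lemma busy2_mass: "busy2 J t = mass J t - idle J t - single J t"
  using mass_eq busy_eq by simp

lemma busy_start_tendsto: "(\<lambda>J. busy J 0) \<longlonglongrightarrow> 1 - start 0"
  unfolding busy_mass idle_start by (intro tendsto_intros mass_start_tendsto)

lemma busy2_start_tendsto: "(\<lambda>J. busy2 J 0) \<longlonglongrightarrow> 1 - start 0 - start 1"
proof -
  have "(\<lambda>J. mass J 0 - start 0 - start 1) \<longlonglongrightarrow> 1 - start 0 - start 1"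
    by (intro tendsto_intros mass_start_tendsto)
  moreover have "\<forall>\<^sub>F J in sequentially. mass J 0 - start 0 - start 1 = busy2 J 0"
    using eventually_ge_at_top[of 1]
    by eventually_elim (simp add: busy2_mass idle_start single_start)
  ultimately show ?thesis by (rule Lim_transform_eventually)
qed

lemma busy_finish_tendsto: "(\<lambda>J. busy J T) \<longlonglongrightarrow> 1 - finish 0"
  unfolding busy_mass idle_finish by (intro tendsto_intros mass_finish_tendsto column_tendsto)

lemma busy2_finish_tendsto: "(\<lambda>J. busy2 J T) \<longlonglongrightarrow> 1 - finish 0 - finish 1"
proof -
  have "(\<lambda>J. mass J T - (\<Sum>j=0..J. z T 0 j) - (\<Sum>j=1..J. z T 1 j)) \<longlonglongrightarrow> 1 - finish 0 - finish 1"
    by (intro tendsto_intros mass_finish_tendsto column_tendsto)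
  moreover have "\<forall>\<^sub>F J in sequentially.
      mass J T - (\<Sum>j=0..J. z T 0 j) - (\<Sum>j=1..J. z T 1 j) = busy2 J T"
    using eventually_ge_at_top[of 1]
    by eventually_elim (simp add: busy2_mass idle_finish single_finish)
  ultimately show ?thesis by (rule Lim_transform_eventually)
qed

lemma excess_start_tendsto:
  assumes "summable (\<lambda>i. real (i - 1) * start i)"
  shows "(\<lambda>J. excess J 0) \<longlonglongrightarrow> (\<Sum>i. real (i - 1) * start i)"
  unfolding excess_def wsum_init using summable_sums[OF assms] by (simp add: sums_def_le)

text \<open>The argument of Fatou's lemma: convergence of the columns suffices, because mass lost in the limit
  \<open>J \<rightarrow> \<infinity>\<close> only lowers the excess.\<close>

lemma excess_finish_bound:
  assumes bound: "\<forall>\<^sub>F J in sequentially. excess J T + g J \<le> h J"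
    and "g \<longlonglongrightarrow> G" "h \<longlonglongrightarrow> H"
  shows "summable (\<lambda>i. real (i - 1) * finish i)"
    and "(\<Sum>i. real (i - 1) * finish i) + G \<le> H"
proof -
  have *: "(\<Sum>i\<le>N. real (i - 1) * finish i) \<le> H - G" for N
  proof -
    have "(\<lambda>J. (\<Sum>i\<le>N. real (i - 1) * (\<Sum>j=i..J. z T i j))) \<longlonglongrightarrow> (\<Sum>i\<le>N. real (i - 1) * finish i)"
      by (intro tendsto_intros column_tendsto)
    moreover have "(\<lambda>J. h J - g J) \<longlonglongrightarrow> H - G"
      by (intro tendsto_intros assms)
    moreover have "\<forall>\<^sub>F J in sequentially.
        (\<Sum>i\<le>N. real (i - 1) * (\<Sum>j=i..J. z T i j)) \<le> h J - g J"
      using bound eventually_ge_at_top[of N]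
    proof eventually_elim
      case (elim J)
      have "(\<Sum>i\<le>N. real (i - 1) * (\<Sum>j=i..J. z T i j)) \<le> excess J T"
        unfolding excess_def wsum_swap using elim z_nonneg T_pos
        by (intro sum_mono2) (auto intro!: mult_nonneg_nonneg sum_nonneg)
      with elim show ?case by linarith
    qed
    ultimately show ?thesis
      by (intro tendsto_le[OF sequentially_bot])
  qed
  show s: "summable (\<lambda>i. real (i - 1) * finish i)"
    by (rule bounded_imp_summable[of _ "H - G"]) (use * finish_nonneg in auto)
  have "(\<Sum>i. real (i - 1) * finish i) \<le> H - G"
    by (rule LIMSEQ_le_const2[of "\<lambda>N. \<Sum>i\<le>N. real (i - 1) * finish i"])
       (use * summable_sums[OF s] in \<open>auto simp: sums_def_le\<close>)
  then show "(\<Sum>i. real (i - 1) * finish i) + G \<le> H" by simp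
qed

context
  assumes summable_start: "summable (\<lambda>i. real (i - 1) * start i)"
begin

lemma good_lyapunov:
  assumes "lam * T \<le> start 0"
  shows "summable (\<lambda>i. real (i - 1) * finish i)"
    and "(\<Sum>i. real (i - 1) * finish i) + max (1 - finish 0) lam
      \<le> (\<Sum>i. real (i - 1) * start i) + max (1 - start 0) lam"
proof -
  have bound: "\<forall>\<^sub>F J in sequentially.
      excess J T + max (busy J T) lam \<le> excess J 0 + max (busy J 0) lam"
    using eventually_truncated
  proof eventually_elim
    case (elim J)
    then interpret truncated_cycle lam T z D J .
    show ?case by (rule good_cycle[OF assms])
  qed
  have G: "(\<lambda>J. max (busy J T) lam) \<longlonglongrightarrow> max (1 - finish 0) lam"
    by (intro tendsto_intros busy_finish_tendsto)
  have H: "(\<lambda>J. excess J 0 + max (busy J 0) lam)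
      \<longlonglongrightarrow> (\<Sum>i. real (i - 1) * start i) + max (1 - start 0) lam"
    by (intro tendsto_intros busy_start_tendsto excess_start_tendsto summable_start)
  show "summable (\<lambda>i. real (i - 1) * finish i)"
    and "(\<Sum>i. real (i - 1) * finish i) + max (1 - finish 0) lam
      \<le> (\<Sum>i. real (i - 1) * start i) + max (1 - start 0) lam"
    by (rule excess_finish_bound[OF bound G H])+
qed

lemma bad_lyapunov:
  assumes "start 0 < lam * T"
  shows "summable (\<lambda>i. real (i - 1) * finish i)"
    and "(\<Sum>i. real (i - 1) * finish i) + max (1 - finish 0) lam
      \<le> (\<Sum>i. real (i - 1) * start i) + max (1 - start 0) lam
         - (1 - lam - lam * T) * (1 - exp (- T))"
proof -
  \<comment> \<open>By \<open>load\<close> the limit one of the initial masses exceeds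
    \<open>lam + lam * T\<close>, which gives the size condition of \<open>bad_cycle\<close> for
    large \<open>J\<close>.\<close>
  have "\<forall>\<^sub>F J in sequentially. lam + lam * T < mass J 0"
    using mass_start_tendsto load by (intro order_tendstoD(1)[of _ 1]) auto
  with eventually_truncated have bound: "\<forall>\<^sub>F J in sequentially. excess J T + max (busy J T) lam
      \<le> excess J 0 + max (busy J 0) lam - (mass J 0 - lam - lam * T) * (1 - exp (- T))"
  proof eventually_elim
    case (elim J)
    then interpret truncated_cycle lam T z D J by simp
    show ?case using bad_cycle[OF assms] elim by simp
  qed
  have G: "(\<lambda>J. max (busy J T) lam) \<longlonglongrightarrow> max (1 - finish 0) lam"
    by (intro tendsto_intros busy_finish_tendsto)
  have H: "(\<lambda>J. excess J 0 + max (busy J 0) lam - (mass J 0 - lam - lam * T) * (1 - exp (- T)))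
      \<longlonglongrightarrow> (\<Sum>i. real (i - 1) * start i) + max (1 - start 0) lam
         - (1 - lam - lam * T) * (1 - exp (- T))"
    by (intro tendsto_intros busy_start_tendsto mass_start_tendsto excess_start_tendsto summable_start)
  show "summable (\<lambda>i. real (i - 1) * finish i)"
    and "(\<Sum>i. real (i - 1) * finish i) + max (1 - finish 0) lam
      \<le> (\<Sum>i. real (i - 1) * start i) + max (1 - start 0) lam
         - (1 - lam - lam * T) * (1 - exp (- T))"
    by (rule excess_finish_bound[OF bound G H])+
qed

lemma good_excess_sum:
  assumes "lam * T \<le> start 0"
  shows "(\<Sum>i. real (i - 1) * finish i) + T * (1 - finish 0 - finish 1)
      \<le> (\<Sum>i. real (i - 1) * start i)"
proof -
  have "\<forall>\<^sub>F J in sequentially. excess J T + T * busy2 J T \<le> excess J 0"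
    using eventually_truncated
  proof eventually_elim
    case (elim J)
    then interpret truncated_cycle lam T z D J .
    show ?case by (rule good_excess_decrease[OF assms])
  qed
  moreover have "(\<lambda>J. T * busy2 J T) \<longlonglongrightarrow> T * (1 - finish 0 - finish 1)"
    by (intro tendsto_intros busy2_finish_tendsto)
  ultimately show ?thesis
    using excess_start_tendsto[OF summable_start] by (rule excess_finish_bound)
qed

end

context
  assumes good: "lam * T \<le> start 0"
begin

lemma good_busy_finish:
  shows "(1 - start 0 - lam) * exp (- T) \<le> 1 - finish 0 - lam"
    and "1 - finish 0 - lam \<le> (1 - start 0 - start 1)
      + (1 - start 0 - lam - (1 - start 0 - start 1)) * exp (- T)"
proof -
  have "\<forall>\<^sub>F J in sequentially. (busy J 0 - lam) * exp (- T) \<le> busy J T - lam"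
    using eventually_truncated
  proof eventually_elim
    case (elim J)
    then interpret truncated_cycle lam T z D J .
    show ?case by (rule good_busy_lower[OF good])
  qed
  then show "(1 - start 0 - lam) * exp (- T) \<le> 1 - finish 0 - lam"
    by (rule tendsto_le[OF sequentially_bot, rotated 2])
       (intro tendsto_intros busy_start_tendsto busy_finish_tendsto)+
  have "\<forall>\<^sub>F J in sequentially.
      busy J T - lam \<le> busy2 J 0 + (busy J 0 - lam - busy2 J 0) * exp (- T)"
    using eventually_truncated
  proof eventually_elim
    case (elim J)
    then interpret truncated_cycle lam T z D J .
    show ?case by (rule good_busy_upper[OF good])
  qed
  then show "1 - finish 0 - lam \<le> (1 - start 0 - start 1)
      + (1 - start 0 - lam - (1 - start 0 - start 1)) * exp (- T)"
    by (rule tendsto_le[OF sequentially_bot, rotated 2])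
       (intro tendsto_intros busy_start_tendsto busy_finish_tendsto busy2_start_tendsto)+
qed

text \<open>Such an entry is one summand of \<open>busy2 J t\<close>, and \<open>busy2\<close> does
  not increase in a good cycle.\<close>

lemma good_long_queues:
  assumes "0 \<le> t" "t \<le> T" "2 \<le> i" "i \<le> j"
  shows "z t i j \<le> 1 - start 0 - start 1"
proof -
  have "\<forall>\<^sub>F J in sequentially. z t i j \<le> busy2 J 0"
    using eventually_truncated eventually_ge_at_top[of j]
  proof eventually_elim
    case (elim J)
    have "z t i j = (if 2 \<le> i then 1 else 0) * z t i j" using assms by simp
    also have "\<dots> \<le> (\<Sum>i\<le>j. (if 2 \<le> i then 1 else 0) * z t i j)"
      using assms z_nonneg by (intro member_le_sum) auto
    also have "\<dots> \<le> busy2 J t"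
      unfolding busy2_def wsum_def using assms elim z_nonneg
      by (intro member_le_sum[of j "{..J}"]) (auto intro!: sum_nonneg)
    also have "\<dots> \<le> busy2 J 0"
      using truncated_cycle.good_busy2[OF elim(1) good] assms by simp
    finally show ?case .
  qed
  then show ?thesis
    by (rule tendsto_lowerbound[OF busy2_start_tendsto _ sequentially_bot])
qed

text \<open>The minimal estimate is zero throughout, so these three entries form a closed linear
  system: \<open>(0,0)\<close> feeds \<open>(1,1)\<close> at rate \<open>lam\<close>, and
  \<open>(1,1)\<close> drains into \<open>(0,1)\<close>. Each formula comes from a conserved
  quantity.\<close>

lemma good_entries:
  assumes "0 \<le> t" "t < T"
  shows "z t 0 0 = start 0 - lam * t"
    and "z t 1 1 = lam + (start 1 - lam) * exp (- t)"
    and "z t 0 1 = lam * t + (start 1 - lam) * (1 - exp (- t))"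
proof -
  note cont = continuous_on_subset[OF continuous_z]
  have m: "min_est (z s) = 0" if "0 < s" "s < T" for s
  proof -
    have "lam * s < lam * T" using that lam_pos by simp
    then show ?thesis using min_est_zero[of s] that good by simp
  qed
  have p: "assign_prob (z s) 0 0 = 1" if "0 < s" "s < T" for s
    using sum_assign_prob[OF state_z[of s], of 0] m that by simp
  have d00: "((\<lambda>s. z s 0 0) has_real_derivative - lam) (at s)"
    and d11: "((\<lambda>s. z s 1 1) has_real_derivative lam - z s 1 1) (at s)"
    and d01: "((\<lambda>s. z s 0 1) has_real_derivative z s 1 1) (at s)"
    if "0 < s" "s < T" "s \<notin> D" for s
    using deriv_z[OF that, of 0 0] deriv_z[OF that, of 1 1] deriv_z[OF that, of 0 1]
      p[of s] m[of s] that
    by (simp_all add: fluid_rhs_def) (simp_all add: assign_prob_def)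
  have "z t 0 0 + lam * t = z 0 0 0 + lam * 0"
    by (rule constant_between[of 0 t "\<lambda>t. z t 0 0 + lam * t"])
       (use assms in \<open>auto intro!: continuous_intros cont derivative_eq_intros d00\<close>)
  then show "z t 0 0 = start 0 - lam * t" by simp
  have "(z t 1 1 - lam) * exp t = (z 0 1 1 - lam) * exp 0"
    by (rule constant_between[of 0 t "\<lambda>t. (z t 1 1 - lam) * exp t"])
       (use assms in \<open>auto intro!: continuous_intros cont derivative_eq_intros d11 simp: algebra_simps simp del: One_nat_def\<close>)
  then show z11: "z t 1 1 = lam + (start 1 - lam) * exp (- t)"
    by (simp add: exp_minus field_simps)
  have "z t 0 1 + z t 1 1 - lam * t = z 0 0 1 + z 0 1 1 - lam * 0"
    by (rule constant_between[of 0 t "\<lambda>t. z t 0 1 + z t 1 1 - lam * t"])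
       (use assms in \<open>auto intro!: continuous_intros cont derivative_eq_intros d11 d01 simp: algebra_simps simp del: One_nat_def\<close>)
  then show "z t 0 1 = lam * t + (start 1 - lam) * (1 - exp (- t))"
    using z11 z_init[of 0 1] by (simp add: algebra_simps)
qed

end

end

subsection \<open>Convergence along the update moments\<close>

text \<open>Once \<open>c k < \<eta> * (1 - e)\<close>, the quantity
  \<open>\<bar>a k\<bar> - \<eta>\<close> shrinks by the factor \<open>e\<close> in each step. Half
  of \<epsilon> is spent on \<eta> and half on the geometric term.\<close>

lemma contraction_tendsto_zero:
  fixes a c :: "nat \<Rightarrow> real"
  assumes e: "0 \<le> e" "e < 1" and c: "c \<longlonglongrightarrow> 0"
    and step: "\<And>k. K \<le> k \<Longrightarrow> \<bar>a (Suc k)\<bar> \<le> e * \<bar>a k\<bar> + c k"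
  shows "a \<longlonglongrightarrow> 0"
proof (rule tendsto_rabs_zero_cancel, rule order_tendstoI)
  fix \<epsilon> :: real assume "0 < \<epsilon>"
  define \<eta> where "\<eta> = \<epsilon> / 2"
  have \<eta>: "0 < \<eta>" using \<open>0 < \<epsilon>\<close> by (simp add: \<eta>_def)
  have "\<forall>\<^sub>F k in sequentially. c k < \<eta> * (1 - e)"
    using c \<eta> e by (intro order_tendstoD(2)[of _ 0]) auto
  then obtain N where N: "\<And>k. N \<le> k \<Longrightarrow> c k < \<eta> * (1 - e)"
    by (auto simp: eventually_sequentially)
  define M where "M = max K N"
  have *: "\<bar>a (M + n)\<bar> - \<eta> \<le> e ^ n * \<bar>a M\<bar>" for n
  proof (induction n)
    case (Suc n)
    have "\<bar>a (M + Suc n)\<bar> - \<eta> \<le> e * (\<bar>a (M + n)\<bar> - \<eta>)"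
      using step[of "M + n"] N[of "M + n"] max.cobounded1[of K N] max.cobounded2[of N K]
      by (simp add: M_def algebra_simps trans_le_add1 trans_le_add2)
    also have "\<dots> \<le> e * (e ^ n * \<bar>a M\<bar>)"
      using Suc e by (intro mult_left_mono)
    finally show ?case by (simp add: algebra_simps)
  qed (use \<eta> in simp)
  have "(\<lambda>n. e ^ n * \<bar>a M\<bar>) \<longlonglongrightarrow> 0 * \<bar>a M\<bar>"
    using e by (intro tendsto_intros LIMSEQ_power_zero) auto
  then have "\<forall>\<^sub>F n in sequentially. e ^ n * \<bar>a M\<bar> < \<eta>"
    using \<eta> by (intro order_tendstoD(2)[of _ 0]) auto
  then have "\<forall>\<^sub>F n in sequentially. \<bar>a (n + M)\<bar> < \<epsilon>"
  proof eventually_elim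
    case (elim n)
    then show ?case using *[of n] by (simp add: \<eta>_def add.commute)
  qed
  then show "\<forall>\<^sub>F n in sequentially. \<bar>a n\<bar> < \<epsilon>"
    by (subst (asm) eventually_sequentially_seg)
qed (auto intro!: always_eventually intro: less_le_trans[OF _ abs_ge_zero])

text \<open>Serves twice: the decrements of the Lyapunov function rule out late bad cycles, and
  those of the excess bound the long queues.\<close>

lemma decseq_decrement_tendsto_zero:
  fixes f :: "nat \<Rightarrow> real"
  assumes "\<And>k. K \<le> k \<Longrightarrow> f (Suc k) \<le> f k" "\<And>k. B \<le> f k"
  shows "(\<lambda>k. f k - f (Suc k)) \<longlonglongrightarrow> 0"
proof -
  have "decseq (\<lambda>n. f (n + K))"
    by (rule decseq_SucI) (use assms in auto)
  then obtain L where "(\<lambda>n. f (n + K)) \<longlonglongrightarrow> L"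
    using decseq_convergent[of "\<lambda>n. f (n + K)" B] assms(2) by blast
  then have "f \<longlonglongrightarrow> L" by (rule LIMSEQ_offset)
  then have "(\<lambda>k. f k - f (Suc k)) \<longlonglongrightarrow> L - L"
    by (intro tendsto_diff) (auto simp: LIMSEQ_Suc)
  then show ?thesis by simp
qed

text \<open>The left limit at \<open>T\<close> replaces the value after the update, where
  \<open>y\<close> may jump, so that the path is continuous on the closed cycle.\<close>

definition cycle_path :: "real \<Rightarrow> (real \<Rightarrow> nat \<Rightarrow> nat \<Rightarrow> real) \<Rightarrow> nat \<Rightarrow> real \<Rightarrow> nat \<Rightarrow> nat \<Rightarrow> real" where
  "cycle_path T y k t i j =
     (if t < T then y (real k * T + t) i j else left_limit y (real (Suc k) * T) i j)"

definition cycle_changes :: "real \<Rightarrow> (real \<Rightarrow> nat \<Rightarrow> nat \<Rightarrow> real) \<Rightarrow> nat \<Rightarrow> real set" where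
  "cycle_changes T y k =
     {t. real k * T + t \<in> change_times y {real k * T ..< real (Suc k) * T}}"

text \<open>The assumption \<open>load\<close> is \<open>T < 1 / lam - 1\<close> multiplied by
  \<open>lam\<close>.\<close>

locale trajectory =
  fixes lam T :: real and y :: "real \<Rightarrow> nat \<Rightarrow> nat \<Rightarrow> real"
  assumes lam_pos: "0 < lam" and T_pos: "0 < T" and load: "lam * T < 1 - lam"
    and traj: "fluid_trajectory lam T y"
begin

lemma state_y: "0 \<le> t \<Longrightarrow> is_state (y t)"
  by (rule traj[unfolded fluid_trajectory_def, THEN conjunct1, rule_format])

lemma update:
  shows "y (real (Suc k) * T) i i = queue_frac (left_limit y (real (Suc k) * T)) i"
    and "i < j \<Longrightarrow> y (real (Suc k) * T) i j = 0"
proof -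
  note updates = traj[unfolded fluid_trajectory_def, THEN conjunct2, THEN conjunct2, THEN conjunct2,
      rule_format, of "Suc k"]
  show "y (real (Suc k) * T) i i = queue_frac (left_limit y (real (Suc k) * T)) i"
    by (rule updates[THEN conjunct1, rule_format]) simp
  show "i < j \<Longrightarrow> y (real (Suc k) * T) i j = 0"
    by (rule updates[THEN conjunct2, rule_format]) simp_all
qed

lemma update_off_diagonal:
  assumes "i < j"
  shows "y (real k * T) i j = 0"
proof (cases k)
  case 0
  then show ?thesis
    using traj[unfolded fluid_trajectory_def, THEN conjunct2, THEN conjunct1] assms by simp
qed (use update(2)[OF assms] in simp)

section \<open>The trajectory on one cycle, in local time\<close>

context
  fixes k :: nat
begin

private abbreviation "I \<equiv> {real k * T ..< real (Suc k) * T}"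

lemma on_cycle:
  shows "discrete (change_times y I)"
    and "i \<le> j \<Longrightarrow> continuous_on I (\<lambda>t. y t i j)"
    and "i \<le> j \<Longrightarrow> \<exists>L. ((\<lambda>t. y t i j) \<longlongrightarrow> L) (at_left (real (Suc k) * T))"
    and "i \<le> j \<Longrightarrow> t \<in> I - change_times y I \<Longrightarrow>
      ((\<lambda>s. y s i j) has_real_derivative fluid_rhs lam (y t) i j) (at t within I)"
proof -
  note cycle = traj[unfolded fluid_trajectory_def Let_def, THEN conjunct2, THEN conjunct2,
      THEN conjunct1, rule_format, of k, folded Suc_eq_plus1]
  show "discrete (change_times y I)"
    by (rule conjunct1[OF cycle])
  assume ij: "i \<le> j"
  note entry = conjunct2[OF cycle, rule_format, OF ij]
  show "continuous_on I (\<lambda>t. y t i j)"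
    by (rule conjunct1[OF entry])
  show "\<exists>L. ((\<lambda>t. y t i j) \<longlongrightarrow> L) (at_left (real (Suc k) * T))"
    by (rule conjunct1[OF conjunct2[OF entry]])
  show "((\<lambda>s. y s i j) has_real_derivative fluid_rhs lam (y t) i j) (at t within I)"
    if "t \<in> I - change_times y I"
    using conjunct2[OF conjunct2[OF entry]] that by (rule bspec)
qed

lemma left_limit_tendsto:
  assumes "i \<le> j"
  shows "((\<lambda>t. y (real k * T + t) i j) \<longlongrightarrow> left_limit y (real (Suc k) * T) i j) (at_left T)"
proof -
  obtain L where L: "((\<lambda>t. y t i j) \<longlongrightarrow> L) (at_left (real (Suc k) * T))"
    using on_cycle(3)[OF assms] by blast
  then have "left_limit y (real (Suc k) * T) i j = L"
    unfolding left_limit_def by (intro tendsto_Lim) auto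
  moreover have "filterlim (\<lambda>t. real k * T + t) (at_left (real (Suc k) * T)) (at_left T)"
    unfolding filterlim_at
    by (auto intro!: tendsto_eq_intros simp: eventually_at_filter algebra_simps)
  ultimately show ?thesis using filterlim_compose[OF L] by simp
qed

lemma continuous_cycle_path:
  assumes "i \<le> j"
  shows "continuous_on {0..T} (\<lambda>t. cycle_path T y k t i j)"
proof -
  have c: "continuous_on {0..<T} (\<lambda>t. y (real k * T + t) i j)"
    by (rule continuous_on_compose2[OF on_cycle(2)[OF assms]])
       (auto intro!: continuous_intros simp: algebra_simps)
  have "((\<lambda>t. cycle_path T y k t i j) \<longlongrightarrow> cycle_path T y k x i j) (at x within {0..T})"
    if x: "x \<in> {0..T}" for x
  proof (cases "x = T")
    case True
    have "at T within {0..T} = at_left T"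
      using T_pos by (simp add: at_within_Icc_at_left)
    moreover have "\<forall>\<^sub>F t in at_left T. y (real k * T + t) i j = cycle_path T y k t i j"
      by (simp add: cycle_path_def eventually_at_filter)
    ultimately show ?thesis
      using Lim_transform_eventually[OF left_limit_tendsto[OF assms]] True by (simp add: cycle_path_def)
  next
    case False
    then have xT: "x < T" using x by simp
    have "((\<lambda>t. y (real k * T + t) i j) \<longlongrightarrow> y (real k * T + x) i j) (at x within {0..<T})"
      using c x xT by (simp add: continuous_on_def)
    moreover have "at x within {0..<T} = at x within {0..T}"
      by (rule at_within_nhd[of x "{..<T}"]) (use xT in auto)
    ultimately have "((\<lambda>t. y (real k * T + t) i j) \<longlongrightarrow> y (real k * T + x) i j) (at x within {0..T})"
      by simp
    moreover have "\<forall>\<^sub>F t in at x within {0..T}. y (real k * T + t) i j = cycle_path T y k t i j"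
      unfolding eventually_at_topological
      by (rule exI[of _ "{..<T}"]) (use xT in \<open>auto simp: cycle_path_def\<close>)
    ultimately have "((\<lambda>t. cycle_path T y k t i j) \<longlongrightarrow> y (real k * T + x) i j) (at x within {0..T})"
      by (rule Lim_transform_eventually)
    then show ?thesis using xT by (simp add: cycle_path_def)
  qed
  then show ?thesis by (simp add: continuous_on_def)
qed

text \<open>Everything is translated by \<open>real k * T\<close>. Inside the cycle the derivative
  relative to the half-open interval is the ordinary one, and finiteness of the exceptions away from
  \<open>T\<close> comes from discreteness.\<close>

lemma fluid_cycle_path: "fluid_cycle lam T (cycle_path T y k) (cycle_changes T y k)"
proof
  show "finite (cycle_changes T y k \<inter> {0..c})" if "c < T" for c
  proof -
    have "finite (change_times y I \<inter> {real k * T..real k * T + c})"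
      by (rule finite_discrete_change_times[OF on_cycle(1)]) (use that in \<open>simp add: algebra_simps\<close>)
    then have "finite ((\<lambda>t. t - real k * T) ` (change_times y I \<inter> {real k * T..real k * T + c}))"
      by simp
    moreover have "cycle_changes T y k \<inter> {0..c} \<subseteq>
        (\<lambda>t. t - real k * T) ` (change_times y I \<inter> {real k * T..real k * T + c})"
    proof
      fix t assume "t \<in> cycle_changes T y k \<inter> {0..c}"
      then show "t \<in> (\<lambda>t. t - real k * T) ` (change_times y I \<inter> {real k * T..real k * T + c})"
        by (intro image_eqI[where x = "real k * T + t"]) (simp_all add: cycle_changes_def)
    qed
    ultimately show ?thesis by (rule rev_finite_subset)
  qed
  show "is_state (cycle_path T y k t)" if "0 \<le> t" "t < T" for t
  proof -
    have "cycle_path T y k t = y (real k * T + t)"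
      using that by (intro ext) (simp add: cycle_path_def)
    then show ?thesis using state_y[of "real k * T + t"] that T_pos by simp
  qed
  show "cycle_path T y k 0 i j = 0" if "i < j" for i j
    using T_pos that by (simp add: cycle_path_def update_off_diagonal)
  show "((\<lambda>s. cycle_path T y k s i j) has_real_derivative fluid_rhs lam (cycle_path T y k t) i j) (at t)"
    if t: "0 < t" "t < T" "t \<notin> cycle_changes T y k" "i \<le> j" for t i j
  proof -
    have tI: "real k * T + t \<in> {real k * T<..<real (Suc k) * T}"
      using t by (simp add: algebra_simps)
    have "((\<lambda>s. y s i j) has_real_derivative fluid_rhs lam (y (real k * T + t)) i j)
        (at (real k * T + t) within I)"
      by (rule on_cycle(4)) (use t tI in \<open>auto simp: cycle_changes_def\<close>)
    moreover have "at (real k * T + t) within I = at (real k * T + t)"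
      by (rule at_within_interior) (use tI in \<open>simp add: interior_atLeastLessThan\<close>)
    ultimately have "((\<lambda>s. y (real k * T + s) i j) has_real_derivative
        fluid_rhs lam (y (real k * T + t)) i j) (at t)"
      using DERIV_shift[of "\<lambda>s. y s i j" _ t "real k * T"] by (simp add: add.commute)
    moreover have "cycle_path T y k t = y (real k * T + t)"
      using t by (intro ext) (simp add: cycle_path_def)
    ultimately have "((\<lambda>s. y (real k * T + s) i j) has_real_derivative
        fluid_rhs lam (cycle_path T y k t) i j) (at t)"
      by simp
    then show ?thesis
      by (rule has_field_derivative_transform_within_open[where S = "{..<T}"])
         (use t(2) in \<open>simp_all add: cycle_path_def\<close>)
  qed
qed (use lam_pos T_pos load continuous_cycle_path in auto)

lemma cycle_path_start: "cycle_path T y k 0 = y (real k * T)"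
  using T_pos by (intro ext) (simp add: cycle_path_def)

lemma cycle_path_inside: "t < T \<Longrightarrow> cycle_path T y k t = y (real k * T + t)"
  by (intro ext) (simp add: cycle_path_def)

text \<open>This links consecutive cycles: what one cycle leaves in its columns is the diagonal from
  which the next one starts.\<close>

lemma update_diagonal:
  "queue_frac (cycle_path T y k T) i = y (real (Suc k) * T) i i"
proof -
  have "cycle_path T y k T = left_limit y (real (Suc k) * T)"
    by (intro ext) (simp add: cycle_path_def)
  then show ?thesis using update(1)[of k i] by simp
qed

end

section \<open>The sequence of states at update moments\<close>

definition x :: "nat \<Rightarrow> nat \<Rightarrow> real" where "x k i = y (real k * T) i i"

text \<open>The fraction of servers with at least two jobs, written as a complement to avoid an
  infinite sum.\<close>

definition tail2 :: "nat \<Rightarrow> real" where "tail2 k = 1 - x k 0 - x k 1"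

text \<open>The value is meaningful only for a summable series, so summability accompanies it
  through the steps below.\<close>

definition excess_sum :: "nat \<Rightarrow> real" where "excess_sum k = (\<Sum>i. real (i - 1) * x k i)"

lemma x_nonneg: "0 \<le> x k i"
  using state_y[of "real k * T"] T_pos by (simp add: x_def is_state_def)

lemma x_sums: "x k sums 1"
  unfolding x_def[abs_def]
  by (rule diagonal_state_sums[of "y (real k * T)"]) (use state_y T_pos update_off_diagonal in auto)

lemma sum_x_le_1:
  assumes "finite A"
  shows "sum (x k) A \<le> 1"
proof -
  have "sum (x k) A \<le> suminf (x k)"
    using x_nonneg sums_summable[OF x_sums] assms by (intro sum_le_suminf) auto
  also have "\<dots> = 1"
    by (rule sums_unique[OF x_sums, symmetric])
  finally show ?thesis .
qed

lemma tail2_nonneg: "0 \<le> tail2 k"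
  using sum_x_le_1[of "{0, 1}" k] by (simp add: tail2_def)

lemma x_le_tail2: "2 \<le> i \<Longrightarrow> x k i \<le> tail2 k"
  using sum_x_le_1[of "{0, 1, i}" k] by (simp add: tail2_def)

lemma excess_sum_nonneg: "summable (\<lambda>i. real (i - 1) * x k i) \<Longrightarrow> 0 \<le> excess_sum k"
  unfolding excess_sum_def using x_nonneg by (intro suminf_nonneg) auto

lemmas cycle_simps = cycle_path_start update_diagonal x_def[symmetric]
  tail2_def[symmetric] excess_sum_def[symmetric]

lemma lyapunov_step:
  assumes "summable (\<lambda>i. real (i - 1) * x k i)"
  shows "summable (\<lambda>i. real (i - 1) * x (Suc k) i)"
    and "excess_sum (Suc k) + max (1 - x (Suc k) 0) lam \<le> excess_sum k + max (1 - x k 0) lam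
      - (if x k 0 < lam * T then (1 - lam - lam * T) * (1 - exp (- T)) else 0)"
proof -
  note good = fluid_cycle.good_lyapunov[OF fluid_cycle_path[of k],
      unfolded cycle_simps, OF assms]
  note bad = fluid_cycle.bad_lyapunov[OF fluid_cycle_path[of k],
      unfolded cycle_simps, OF assms]
  show "summable (\<lambda>i. real (i - 1) * x (Suc k) i)"
    using good(1) bad(1) by (meson linorder_not_le)
  show "excess_sum (Suc k) + max (1 - x (Suc k) 0) lam \<le> excess_sum k + max (1 - x k 0) lam
      - (if x k 0 < lam * T then (1 - lam - lam * T) * (1 - exp (- T)) else 0)"
    using good(2) bad(2) by (simp only: not_less if_False if_True diff_zero split: if_split) blast
qed

context
  fixes k assumes good: "lam * T \<le> x k 0"
begin

lemma excess_sum_step: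
  assumes "summable (\<lambda>i. real (i - 1) * x k i)"
  shows "excess_sum (Suc k) + T * tail2 (Suc k) \<le> excess_sum k"
  by (rule fluid_cycle.good_excess_sum[OF fluid_cycle_path[of k], unfolded cycle_simps, OF assms good])

lemma idle_step:
  shows "(1 - x k 0 - lam) * exp (- T) \<le> 1 - x (Suc k) 0 - lam"
    and "1 - x (Suc k) 0 - lam \<le> tail2 k + (1 - x k 0 - lam - tail2 k) * exp (- T)"
  by (rule fluid_cycle.good_busy_finish[OF fluid_cycle_path[of k], unfolded cycle_simps, OF good])+

lemma long_queues_le:
  assumes "0 \<le> t" "t < T" "2 \<le> i" "i \<le> j"
  shows "y (real k * T + t) i j \<le> tail2 k"
  using fluid_cycle.good_long_queues[OF fluid_cycle_path[of k], unfolded cycle_simps, OF good]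
    cycle_path_inside[OF assms(2), of k] assms
  by (metis less_imp_le)

lemma entries:
  assumes "0 \<le> t" "t < T"
  shows "y (real k * T + t) 0 0 = x k 0 - lam * t"
    and "y (real k * T + t) 1 1 = lam + (x k 1 - lam) * exp (- t)"
    and "y (real k * T + t) 0 1 = lam * t + (x k 1 - lam) * (1 - exp (- t))"
  by (rule fluid_cycle.good_entries[OF fluid_cycle_path[of k],
      unfolded cycle_simps, OF good assms, unfolded cycle_path_inside[OF assms(2)]])+

end

text \<open>At update moments the state is diagonal with total mass one, so
  \<open>tail2 k = 0\<close> leaves only two entries, and the first determines the second.\<close>

lemma y_star_iff: "y (real k * T) = y_star lam \<longleftrightarrow> x k 0 = 1 - lam \<and> tail2 k = 0"
proof
  assume "y (real k * T) = y_star lam"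
  then show "x k 0 = 1 - lam \<and> tail2 k = 0"
    by (simp add: x_def tail2_def y_star_def)
next
  assume r: "x k 0 = 1 - lam \<and> tail2 k = 0"
  show "y (real k * T) = y_star lam"
  proof (intro ext)
    fix i j
    have "y (real k * T) i j = 0" if "i \<noteq> j"
      using that update_off_diagonal[of i j k] state_y[of "real k * T"] T_pos
      by (cases "i < j") (auto simp: is_state_def)
    moreover have "x k i = 0" if "2 \<le> i"
      using x_le_tail2[OF that, of k] x_nonneg[of k i] r by simp
    moreover have "x k 1 = lam" using r by (simp add: tail2_def)
    ultimately show "y (real k * T) i j = y_star lam i j"
      using r by (cases "i = j"; cases i; cases "i - 1") (auto simp: y_star_def x_def)
  qed
qed

lemma fixed_point:
  assumes "y 0 = y_star lam"
  shows "y (real k * T) = y_star lam"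
proof -
  \<comment> \<open>The induction also carries a vanishing excess, since this is what forces
    \<open>tail2\<close> to vanish at the next update. With \<open>tail2 k = 0\<close> the two
    bounds of \<open>idle_step\<close> pin \<open>x (Suc k) 0\<close> to \<open>1 - lam\<close>, and
    \<open>load\<close> makes every cycle good.\<close>
  have "x k 0 = 1 - lam \<and> tail2 k = 0 \<and> summable (\<lambda>i. real (i - 1) * x k i) \<and> excess_sum k \<le> 0"
  proof (induction k)
    case 0
    have "x 0 i = (if i = 0 then 1 - lam else if i = 1 then lam else 0)" for i
      using assms by (auto simp: x_def y_star_def)
    then have "(\<lambda>i. real (i - 1) * x 0 i) = (\<lambda>i. 0)" by auto
    then show ?case
      using y_star_iff[of 0] assms by (simp add: excess_sum_def)
  next
    case (Suc k)
    then have good: "lam * T \<le> x k 0" using load by simp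
    have "x (Suc k) 0 = 1 - lam"
      using idle_step[OF good] Suc by simp
    moreover have s: "summable (\<lambda>i. real (i - 1) * x (Suc k) i)"
      using lyapunov_step(1) Suc by simp
    moreover have "excess_sum (Suc k) + T * tail2 (Suc k) \<le> 0"
      using excess_sum_step[OF good] Suc by simp
    moreover have "0 \<le> T * tail2 (Suc k)"
      using tail2_nonneg[of "Suc k"] T_pos by simp
    moreover have "T * tail2 (Suc k) \<le> 0 \<Longrightarrow> tail2 (Suc k) = 0"
      using T_pos tail2_nonneg[of "Suc k"] by (simp add: mult_le_0_iff)
    ultimately show ?case using excess_sum_nonneg[OF s] by linarith
  qed
  then show ?thesis using y_star_iff by blast
qed

section \<open>Convergence from initial states of finite excess\<close>

context
  assumes summable_0: "summable (\<lambda>i. real (i - 1) * x 0 i)"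
begin

lemma summable_x: "summable (\<lambda>i. real (i - 1) * x k i)"
  by (induction k) (use summable_0 lyapunov_step(1) in auto)

text \<open>The Lyapunov function is nonnegative and nonincreasing, so its decrements tend to zero,
  while each bad cycle costs at least the fixed amount \<open>d > 0\<close>.\<close>

lemma eventually_good:
  obtains K where "\<And>k. K \<le> k \<Longrightarrow> lam * T \<le> x k 0"
proof -
  define V where "V k = excess_sum k + max (1 - x k 0) lam" for k
  define d where "d = (1 - lam - lam * T) * (1 - exp (- T))"
  have "0 < d" using load T_pos by (simp add: d_def)
  have step: "V (Suc k) \<le> V k - (if x k 0 < lam * T then d else 0)" for k
    unfolding V_def d_def by (rule lyapunov_step(2)[OF summable_x])
  have "(\<lambda>k. V k - V (Suc k)) \<longlonglongrightarrow> 0"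
  proof (rule decseq_decrement_tendsto_zero[of 0 V 0])
    show "V (Suc k) \<le> V k" for k
      using step[of k] \<open>0 < d\<close> by (simp split: if_splits)
    show "0 \<le> V k" for k
      using excess_sum_nonneg[OF summable_x, of k] lam_pos by (simp add: V_def)
  qed
  then have "\<forall>\<^sub>F k in sequentially. V k - V (Suc k) < d"
    using \<open>0 < d\<close> by (rule order_tendstoD)
  then obtain K where K: "\<And>k. K \<le> k \<Longrightarrow> V k - V (Suc k) < d"
    by (auto simp: eventually_sequentially)
  show ?thesis
  proof
    show "lam * T \<le> x k 0" if "K \<le> k" for k
      using K[OF that] step[of k] by (simp split: if_splits)
  qed
qed

text \<open>From some cycle on, \<open>T * tail2 (Suc k)\<close> is at most the decrement of the
  excess, and these decrements tend to zero.\<close>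

lemma tail2_tendsto: "tail2 \<longlonglongrightarrow> 0"
proof -
  obtain K where K: "\<And>k. K \<le> k \<Longrightarrow> lam * T \<le> x k 0" using eventually_good by blast
  have step: "excess_sum (Suc k) + T * tail2 (Suc k) \<le> excess_sum k" if "K \<le> k" for k
    using excess_sum_step[OF K[OF that] summable_x] .
  have "(\<lambda>k. excess_sum k - excess_sum (Suc k)) \<longlonglongrightarrow> 0"
  proof (rule decseq_decrement_tendsto_zero[of K _ 0])
    show "excess_sum (Suc k) \<le> excess_sum k" if "K \<le> k" for k
      using step[OF that] mult_nonneg_nonneg[of T "tail2 (Suc k)"] T_pos tail2_nonneg[of "Suc k"]
      by linarith
  qed (rule excess_sum_nonneg[OF summable_x])
  from tendsto_divide[OF this tendsto_const[of T]]
  have lim: "(\<lambda>k. (excess_sum k - excess_sum (Suc k)) / T) \<longlonglongrightarrow> 0"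
    using T_pos by simp
  have "(\<lambda>k. tail2 (Suc k)) \<longlonglongrightarrow> 0"
  proof (rule tendsto_sandwich[OF _ _ tendsto_const lim])
    show "\<forall>\<^sub>F k in sequentially. tail2 (Suc k) \<le> (excess_sum k - excess_sum (Suc k)) / T"
      using eventually_ge_at_top[of K]
    proof eventually_elim
      case (elim k)
      then show ?case using step[of k] T_pos by (simp add: field_simps)
    qed
  qed (use tail2_nonneg in auto)
  then show ?thesis by (simp add: filterlim_sequentially_Suc)
qed

text \<open>The deviation of the busy fraction from \<open>lam\<close> contracts by
  \<open>exp (- T)\<close> per cycle, perturbed by \<open>tail2 k\<close>, which vanishes in the
  limit.\<close>

lemma x_0_tendsto: "(\<lambda>k. x k 0) \<longlonglongrightarrow> 1 - lam"
proof -
  obtain K where K: "\<And>k. K \<le> k \<Longrightarrow> lam * T \<le> x k 0" using eventually_good by blast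
  have "(\<lambda>k. 1 - x k 0 - lam) \<longlonglongrightarrow> 0"
  proof (rule contraction_tendsto_zero[of "exp (- T)" tail2 K])
    fix k assume "K \<le> k"
    note s = idle_step[OF K[OF this]]
    have upper: "1 - x (Suc k) 0 - lam \<le> tail2 k + (1 - x k 0 - lam) * exp (- T)"
    proof -
      have "(1 - x k 0 - lam - tail2 k) * exp (- T) \<le> (1 - x k 0 - lam) * exp (- T)"
        using tail2_nonneg[of k] by (intro mult_right_mono) auto
      then show ?thesis using s(2) by linarith
    qed
    have "- \<bar>1 - x k 0 - lam\<bar> * exp (- T) \<le> (1 - x k 0 - lam) * exp (- T)"
      "(1 - x k 0 - lam) * exp (- T) \<le> \<bar>1 - x k 0 - lam\<bar> * exp (- T)"
      by (intro mult_right_mono; simp)+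
    then show "\<bar>1 - x (Suc k) 0 - lam\<bar> \<le> exp (- T) * \<bar>1 - x k 0 - lam\<bar> + tail2 k"
      using s(1) upper tail2_nonneg[of k]
      unfolding abs_le_iff mult.commute[of "exp (- T)"] mult_minus_left by linarith
  qed (use T_pos tail2_tendsto in auto)
  from tendsto_diff[OF tendsto_const[of "1 - lam"] this] show ?thesis by simp
qed

lemma x_1_tendsto: "(\<lambda>k. x k 1) \<longlonglongrightarrow> lam"
proof -
  have "(\<lambda>k. 1 - x k 0 - tail2 k) \<longlonglongrightarrow> 1 - (1 - lam) - 0"
    by (intro tendsto_intros x_0_tendsto tail2_tendsto)
  then show ?thesis by (simp add: tail2_def)
qed

lemma x_tendsto_0: "2 \<le> i \<Longrightarrow> (\<lambda>k. x k i) \<longlonglongrightarrow> 0"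
  by (rule tendsto_sandwich[OF _ _ tendsto_const tail2_tendsto]) (use x_nonneg x_le_tail2 in auto)

lemma update_limits:
  assumes "i \<le> j"
  shows "(\<lambda>k. y (real k * T) i j) \<longlonglongrightarrow> y_star lam i j"
proof (cases "i = j")
  case True
  consider "i = 0" | "i = 1" | "2 \<le> i" by linarith
  then have "(\<lambda>k. x k i) \<longlonglongrightarrow> y_star lam i i"
    by cases (use x_0_tendsto x_1_tendsto x_tendsto_0 in \<open>auto simp: y_star_def\<close>)
  then show ?thesis using True by (simp add: x_def)
next
  case False
  then have "i < j" using assms by simp
  moreover from this have "y_star lam i j = 0" by (auto simp: y_star_def)
  ultimately show ?thesis by (simp add: update_off_diagonal)
qed

text \<open>The explicit formulas of good cycles hold for all large \<open>k\<close>, so the limits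
  at update moments carry over; the long queues are squeezed below \<open>tail2 k\<close>.\<close>

lemma within_cycle_limits:
  assumes t: "0 \<le> t" "t < T"
  shows "(\<lambda>k. y (real k * T + t) 0 0) \<longlonglongrightarrow> 1 - lam - lam * t"
    and "(\<lambda>k. y (real k * T + t) 0 1) \<longlonglongrightarrow> lam * t"
    and "(\<lambda>k. y (real k * T + t) 1 1) \<longlonglongrightarrow> lam"
    and "2 \<le> i \<Longrightarrow> i \<le> j \<Longrightarrow> (\<lambda>k. y (real k * T + t) i j) \<longlonglongrightarrow> 0"
proof -
  obtain K where K: "\<And>k. K \<le> k \<Longrightarrow> lam * T \<le> x k 0" using eventually_good by blast
  have good: "\<forall>\<^sub>F k in sequentially. lam * T \<le> x k 0"
    using eventually_ge_at_top[of K] K by (rule eventually_mono)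
  have "(\<lambda>k. x k 0 - lam * t) \<longlonglongrightarrow> 1 - lam - lam * t"
    by (intro tendsto_intros x_0_tendsto)
  then show "(\<lambda>k. y (real k * T + t) 0 0) \<longlonglongrightarrow> 1 - lam - lam * t"
    by (rule Lim_transform_eventually) (use good entries(1) t in \<open>auto elim!: eventually_mono\<close>)
  have "(\<lambda>k. lam * t + (x k 1 - lam) * (1 - exp (- t))) \<longlonglongrightarrow> lam * t + (lam - lam) * (1 - exp (- t))"
    by (intro tendsto_intros x_1_tendsto)
  then have "(\<lambda>k. y (real k * T + t) 0 1) \<longlonglongrightarrow> lam * t + (lam - lam) * (1 - exp (- t))"
    by (rule Lim_transform_eventually)
       (use good in eventually_elim, use entries(3) t in simp)
  then show "(\<lambda>k. y (real k * T + t) 0 1) \<longlonglongrightarrow> lam * t" by simp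
  have "(\<lambda>k. lam + (x k 1 - lam) * exp (- t)) \<longlonglongrightarrow> lam + (lam - lam) * exp (- t)"
    by (intro tendsto_intros x_1_tendsto)
  then have "(\<lambda>k. y (real k * T + t) 1 1) \<longlonglongrightarrow> lam + (lam - lam) * exp (- t)"
    by (rule Lim_transform_eventually)
       (use good in eventually_elim, use entries(2) t in simp)
  then show "(\<lambda>k. y (real k * T + t) 1 1) \<longlonglongrightarrow> lam" by simp
  show "(\<lambda>k. y (real k * T + t) i j) \<longlonglongrightarrow> 0" if "2 \<le> i" "i \<le> j"
  proof (rule tendsto_sandwich[OF _ _ tendsto_const tail2_tendsto])
    have "0 \<le> y (real k * T + t) i j" for k
      using state_y[of "real k * T + t"] t T_pos by (simp add: is_state_def)
    then show "\<forall>\<^sub>F k in sequentially. 0 \<le> y (real k * T + t) i j" by simp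
    show "\<forall>\<^sub>F k in sequentially. y (real k * T + t) i j \<le> tail2 k"
      using good by eventually_elim (use long_queues_le t that in simp)
  qed
qed

end

text \<open>Here the finiteness of Q(0) enters: at time 0 the state is diagonal, so its queue
  fractions are \<open>x 0 i\<close>, and the weight \<open>i - 1\<close> is dominated by
  \<open>i\<close>.\<close>

lemma mean_queue_finite:
  assumes "mean_queue (y 0) < \<infinity>"
  shows "summable (\<lambda>i. real (i - 1) * x 0 i)"
proof -
  have "queue_frac (y 0) i = x 0 i" for i
  proof -
    have "(y 0 i has_sum y 0 i i) {i..}"
      using has_sum_finite[of "{i}" "y 0 i"] update_off_diagonal[of i _ 0]
      by (subst has_sum_cong_neutral[where T = "{i}" and g = "y 0 i"]) auto
    then show ?thesis by (simp add: queue_frac_def x_def infsumI)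
  qed
  then have "(\<Sum>i. ennreal (real i * x 0 i)) \<noteq> top"
    using assms by (simp add: mean_queue_def)
  then have "summable (\<lambda>i. real i * x 0 i)"
    using x_nonneg by (intro summable_suminf_not_top) auto
  then show ?thesis
    by (rule summable_comparison_test[rotated])
       (auto intro!: exI[of _ 0] mult_right_mono simp: x_nonneg abs_mult)
qed

lemma time_decomposition:
  assumes "0 \<le> t"
  obtains k s where "0 \<le> s" "s < T" "t = real k * T + s"
proof -
  define k where "k = nat \<lfloor>t / T\<rfloor>"
  have "real k = of_int \<lfloor>t / T\<rfloor>" using assms T_pos by (simp add: k_def)
  then have "real k \<le> t / T" "t / T < real k + 1" by linarith+
  then have "0 \<le> t - real k * T" "t - real k * T < T"
    using T_pos by (simp_all add: field_simps)
  then show ?thesis using that[of "t - real k * T" k] by simp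
qed

lemma fixed_point_long_queues:
  assumes "y 0 = y_star lam" "2 \<le> i" "i \<le> j" "0 \<le> t"
  shows "y t i j = 0"
proof -
  obtain k s where t: "0 \<le> s" "s < T" "t = real k * T + s"
    using time_decomposition[OF \<open>0 \<le> t\<close>] .
  have "x k 0 = 1 - lam" "tail2 k = 0"
    using fixed_point[OF assms(1), of k] y_star_iff by auto
  then have "y t i j \<le> 0"
    using long_queues_le[of k s i j] load t assms by simp
  then show ?thesis
    using state_y[OF \<open>0 \<le> t\<close>] by (metis is_state_def order_antisym)
qed

lemma fixed_point_entries:
  assumes "y 0 = y_star lam" "0 \<le> t" "t < T"
  shows "y (real k * T + t) 0 0 = 1 - lam - lam * t"
    and "y (real k * T + t) 0 1 = lam * t"
    and "y (real k * T + t) 1 1 = lam"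
proof -
  have "x k 0 = 1 - lam" "tail2 k = 0"
    using fixed_point[OF assms(1), of k] y_star_iff by auto
  then show "y (real k * T + t) 0 0 = 1 - lam - lam * t"
    "y (real k * T + t) 0 1 = lam * t" "y (real k * T + t) 1 1 = lam"
    using entries[of k t] load assms by (simp_all add: tail2_def)
qed

end

theorem proposition4p11:
  fixes lam \<delta> T :: real and y :: "real \<Rightarrow> nat \<Rightarrow> nat \<Rightarrow> real"
  assumes "0 < lam" and "lam < 1"
    and "\<delta> > lam / (1 - lam)" and "T = 1 / \<delta>"
    and "fluid_trajectory lam T y"
  shows "(y 0 = y_star lam \<longrightarrow>
            (\<forall>k::nat. y (real k * T) = y_star lam) \<and>
            (\<forall>k::nat. \<forall>t\<in>{0..<T}.
               y (real k * T + t) 0 0 = 1 - lam - lam * t \<and>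
               y (real k * T + t) 0 1 = lam * t \<and>
               y (real k * T + t) 1 1 = lam) \<and>
            (\<forall>i j. 2 \<le> i \<and> i \<le> j \<longrightarrow> (\<forall>t\<ge>0. y t i j = 0))) \<and>
         (mean_queue (y 0) < \<infinity> \<longrightarrow>
            (\<forall>i j. i \<le> j \<longrightarrow>
               (\<lambda>k. y (real k * T) i j) \<longlonglongrightarrow> y_star lam i j) \<and>
            (\<forall>t\<in>{0..<T}.
               (\<lambda>k. y (real k * T + t) 0 0) \<longlonglongrightarrow> 1 - lam - lam * t \<and>
               (\<lambda>k. y (real k * T + t) 0 1) \<longlonglongrightarrow> lam * t \<and>
               (\<lambda>k. y (real k * T + t) 1 1) \<longlonglongrightarrow> lam \<and>
               (\<forall>i j. 2 \<le> i \<and> i \<le> j \<longrightarrow>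
                  (\<lambda>k. y (real k * T + t) i j) \<longlonglongrightarrow> 0)))"
proof -
  have "0 < lam / (1 - lam)" using assms(1,2) by simp
  then have "0 < \<delta>" using assms(3) by linarith
  \<comment> \<open>Dividing by \<delta> gives the condition \<open>lam * T < 1 - lam\<close>, the
    form in which the bound on \<open>T\<close> is used throughout.\<close>
  moreover have "lam < (1 - lam) * \<delta>"
    using assms(2,3) by (simp add: pos_divide_less_eq mult.commute)
  ultimately have "lam * T < 1 - lam" "0 < T"
    using assms(4) by (simp_all add: pos_divide_less_eq)
  then interpret trajectory lam T y
    using assms(1,5) by unfold_locales
  show ?thesis
    by (intro conjI impI allI ballI)
       (auto intro: fixed_point fixed_point_entries[simplified] fixed_point_long_queues
         update_limits[simplified] within_cycle_limits[simplified] mean_queue_finite[simplified])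
qed

end
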